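(* Let $f\colon \mathbb{R}_+\to\mathbb{R}$ be a continuous, strictly increasing function. Then the following assertions are equivalent to each other: (i) For all $n\in\mathbb{N}$, the $n$-variable mean $\mathscr{A}_f^{[n]}\colon\mathbb{R}_+^n\to\mathbb{R}_+$ is subadditive. (ii) The $2$-variable mean $\mathscr{A}_f^{[2]}\colon\mathbb{R}_+^2\to\mathbb{R}_+$ is subadditive. (iii) The map $\Phi_f\colon f(\mathbb{R}_+)^2\to\mathbb{R}$ defined by $\Phi_f(u,v):=f\big(f^{-1}(u)+f^{-1}(v)\big)$ is concave. (iv) The function $f$ is differentiable with a positive derivative, and the map $\Psi_f\colon\mathbb{R}_+^2\to\mathbb{R}$ defined by $\Psi_f(x,y):=\dfrac{f(x)-f(y)}{f'(y)}$ is subadditive. (v) The function $f$ is differentiable with a positive derivative, its derivative $f'$ is continuously semi-differentiable, and there exists an $\alpha\in[0,\infty]$ such that $f''_+$ is positive on $(0,\alpha)$ and $f''_+=0$ on $[\alpha,\infty)$; furthermore, $\frac{f'}{f''_+}$ is increasing and superadditive on $(0,\alpha)$, where superadditivity means $$\frac{f'}{f''_+}(x+y)\geq \frac{f'}{f''_+}(x)+\frac{f'}{f''_+}(y)\qquad (x,y>0,\ x+y<\alpha).$$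
   Context: $\mathbb{R}_+$ denotes the set of positive real numbers $(0,\infty)$. "Increasing" means nondecreasing (strictness is stated explicitly when meant). For a continuous and strictly monotone $f\colon\mathbb{R}_+\to\mathbb{R}$ and $n\in\mathbb{N}=\{1,2,\dots\}$, the $n$-variable quasi-arithmetic mean is $$\mathscr{A}_f^{[n]}(x_1,\dots,x_n):=f^{-1}\Big(\frac{f(x_1)+\cdots+f(x_n)}{n}\Big)\qquad (x_1,\dots,x_n\in\mathbb{R}_+).$$ A real-valued function $F$ on $\mathbb{R}_+^n$ is subadditive if $F(x+y)\le F(x)+F(y)$ for all $x,y\in\mathbb{R}_+^n$ (componentwise addition). For a function $h\colon D\to\mathbb{R}$ on a nonempty open set $D\subseteq\mathbb{R}$, the one-sided derivatives at $x\in D$ are $h'_-(x)=\lim_{t\to0-}\frac{h(x+t)-h(x)}{t}$ and $h'_+(x)=\lim_{t\to0+}\frac{h(x+t)-h(x)}{t}$. The function $h$ is semi-differentiable at $x$ if both exist (as finite limits). It is continuously semi-differentiable on $D$ if it is semi-differentiable at each point of $D$ and, for all $x\in D$, $$h'_-(x)=\lim_{u\to x-}h'_-(u)=\lim_{u\to x-}h'_+(u)\quad\text{and}\quad h'_+(x)=\lim_{u\to x+}h'_-(u)=\lim_{u\to x+}h'_+(u).$$ For a differentiable $f$ with semi-differentiable derivative, $f''_+:=(f')'_+$ denotes the right derivative of $f'$. The interval $[\alpha,\infty)$ is understood within the domain $\mathbb{R}_+$: it means $(0,\infty)$ if $\alpha=0$ and is empty if $\alpha=\infty$; $(0,\alpha)$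 is empty if $\alpha=0$ and equals $(0,\infty)$ if $\alpha=\infty$. *)

theory Defs
  imports "HOL-Analysis.Analysis"
begin

text \<open>The set of positive reals is \<open>{0<..}\<close>. Functions on it are total functions of type
  \<open>real \<Rightarrow> real\<close> whose values outside \<open>{0<..}\<close> are irrelevant; the inverse \<open>f\<inverse>\<close> of such a
  function is \<open>inv_into {0<..} f\<close>. A point of the \<open>n\<close>-th power is a sequence
  \<open>x :: nat \<Rightarrow> real\<close>, of which only \<open>x 1, \<dots>, x n\<close> matter.\<close>

definition quasi_arith_mean :: "(real \<Rightarrow> real) \<Rightarrow> nat \<Rightarrow> (nat \<Rightarrow> real) \<Rightarrow> real" where
  "quasi_arith_mean f n x = inv_into {0<..} f ((\<Sum>i=1..n. f (x i)) / real n)"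

definition subadditive_pos :: "nat \<Rightarrow> ((nat \<Rightarrow> real) \<Rightarrow> real) \<Rightarrow> bool" where
  "subadditive_pos n F \<longleftrightarrow>
     (\<forall>x y. (\<forall>i\<in>{1..n}. 0 < x i \<and> 0 < y i) \<longrightarrow> F (\<lambda>i. x i + y i) \<le> F x + F y)"

definition Phi :: "(real \<Rightarrow> real) \<Rightarrow> real \<times> real \<Rightarrow> real" where
  "Phi f = (\<lambda>(u, v). f (inv_into {0<..} f u + inv_into {0<..} f v))"

definition Psi :: "(real \<Rightarrow> real) \<Rightarrow> real \<Rightarrow> real \<Rightarrow> real" where
  "Psi f x y = (f x - f y) / deriv f y"

definition differentiable_pos_deriv :: "(real \<Rightarrow> real) \<Rightarrow> bool" where
  "differentiable_pos_deriv f \<longleftrightarrow> (\<forall>x>0. f differentiable (at x) \<and> 0 < deriv f x)"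

text \<open>The one-sided derivatives below are meaningful only where
  \<open>semi_differentiable_at\<close> holds.\<close>

definition left_deriv :: "(real \<Rightarrow> real) \<Rightarrow> real \<Rightarrow> real" where
  "left_deriv h x = (THE d. (h has_real_derivative d) (at_left x))"

definition right_deriv :: "(real \<Rightarrow> real) \<Rightarrow> real \<Rightarrow> real" where
  "right_deriv h x = (THE d. (h has_real_derivative d) (at_right x))"

definition semi_differentiable_at :: "(real \<Rightarrow> real) \<Rightarrow> real \<Rightarrow> bool" where
  "semi_differentiable_at h x \<longleftrightarrow>
     (\<exists>d. (h has_real_derivative d) (at_left x)) \<and> (\<exists>d. (h has_real_derivative d) (at_right x))"

text \<open>For open \<open>D\<close>: then the one-sided limits at \<open>x \<in> D\<close> only involve points of \<open>D\<close>.\<close>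

definition cont_semi_differentiable_on :: "(real \<Rightarrow> real) \<Rightarrow> real set \<Rightarrow> bool" where
  "cont_semi_differentiable_on h D \<longleftrightarrow>
     (\<forall>x\<in>D. semi_differentiable_at h x) \<and>
     (\<forall>x\<in>D. (left_deriv h \<longlongrightarrow> left_deriv h x) (at_left x) \<and>
            (right_deriv h \<longlongrightarrow> left_deriv h x) (at_left x) \<and>
            (left_deriv h \<longlongrightarrow> right_deriv h x) (at_right x) \<and>
            (right_deriv h \<longlongrightarrow> right_deriv h x) (at_right x))"

end

(* If the two-variable mean is subadditive, then Phi is midpoint concave, hence concave, and Jensen's
   inequality gives all n. Concavity of Phi, compared at (f x, f y) and (f y, f x), makes f convex; a
   kink of f at x + y would break concavity of Phi along its level curve, so f is differentiable, and
   Phi lies below its tangent planes, which is exactly subadditivity of Psi. The case y' = y of that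
   inequality makes ln f' concave, so f''_+ exists and lambda = f''_+ / f' is decreasing and right
   continuous; the second order expansion of Psi gives
     lambda(x + y) (A + B)^2 <= lambda(x) A^2 + lambda(y) B^2,
   which for A = 1 / lambda(x), B = 1 / lambda(y) is the superadditivity of 1 / lambda. Conversely,
   by Cauchy-Schwarz superadditivity gives this quadratic inequality, also for one-sided limits of
   lambda, and it says that along every line the right derivative of the derivative of Phi is
   nonpositive. *)

theory Submission
  imports Defs
begin

section \<open>One-sided derivatives and convexity\<close>

text \<open>Assertion (v) yields only one-sided second derivatives, so \<Phi> has no Hessian whose
  sign could be tested. On a line, the arguments x(t), y(t) and their sum leave their positions
  toward sides given by the signs of the velocities A, B and A + B. For an arbitrary choice of sides
  the quadratic inequality may fail; for the sides of one common motion it holds, being the limit of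
  the inequality between right derivatives at the later positions. A vanishing velocity does no
  harm, as it enters squared. The choice A = 1 / lambda(x), B = 1 / lambda(y) is, up to scaling, the
  minimiser of lambda(x) A^2 + lambda(y) B^2 for given A + B. So superadditivity loses nothing, and
  Cauchy-Schwarz leads back. Differentiability at s is obtained from data at s / 2, which may itself
  be a kink. For that reason the two points compared there keep the first argument to the right of s
  / 2 and the second one to the left.\<close>

lemma right_deriv_eqI:
  assumes "(h has_real_derivative d) (at_right x)"
  shows "right_deriv h x = d"
  unfolding right_deriv_def
proof (rule the_equality[where P = "\<lambda>d. (h has_real_derivative d) (at_right x)", OF assms])
  fix e assume "(h has_real_derivative e) (at_right x)"
  with assms show "e = d"
    unfolding has_field_derivative_iff
    using tendsto_unique trivial_limit_at_right_real by blast
qed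

lemma left_deriv_eqI:
  assumes "(h has_real_derivative d) (at_left x)"
  shows "left_deriv h x = d"
  unfolding left_deriv_def
proof (rule the_equality[where P = "\<lambda>d. (h has_real_derivative d) (at_left x)", OF assms])
  fix e assume "(h has_real_derivative e) (at_left x)"
  with assms show "e = d"
    unfolding has_field_derivative_iff
    using tendsto_unique trivial_limit_at_left_real by blast
qed

text \<open>The substitution t -> -t reduces left-hand facts to right-hand ones, so that the
  convexity arguments are carried out only once.\<close>

lemma has_real_derivative_at_left_reflect:
  "(h has_real_derivative d) (at_left x) \<longleftrightarrow>
   ((\<lambda>t. h (- t)) has_real_derivative - d) (at_right (- x))"
proof -
  have eq: "(\<lambda>t. (h (- t) - h (- (- x))) / (t - - x)) = (\<lambda>t. - ((h (- t) - h x) / (- t - x)))"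
    by (rule ext) (simp add: field_split_simps)
  have "((\<lambda>y. (h y - h x) / (y - x)) \<longlongrightarrow> d) (at_left x) \<longleftrightarrow>
      ((\<lambda>t. (h (- t) - h x) / (- t - x)) \<longlongrightarrow> d) (at_right (- x))"
    by (rule filterlim_at_left_to_right)
  also have "\<dots> \<longleftrightarrow> ((\<lambda>t. - ((h (- t) - h x) / (- t - x))) \<longlongrightarrow> - d) (at_right (- x))"
    using tendsto_minus_cancel_left[of "\<lambda>t. (h (- t) - h x) / (- t - x)" "- d"] by simp
  finally show ?thesis
    unfolding has_field_derivative_iff eq .
qed

lemma convex_on_reflect:
  fixes h :: "real \<Rightarrow> real"
  assumes "convex_on S h"
  shows "convex_on (uminus ` S) (\<lambda>t. h (- t))"
  unfolding convex_on_def
proof (intro conjI ballI allI impI)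
  show "convex (uminus ` S)"
    using assms convex_negations convex_on_imp_convex by blast
next
  fix x y u v :: real
  assume "x \<in> uminus ` S" "y \<in> uminus ` S" "0 \<le> u" "0 \<le> v" "u + v = 1"
  then have "h (u *\<^sub>R (- x) + v *\<^sub>R (- y)) \<le> u * h (- x) + v * h (- y)"
    using assms unfolding convex_on_def by auto
  then show "h (- (u *\<^sub>R x + v *\<^sub>R y)) \<le> u * h (- x) + v * h (- y)"
    by simp
qed

lemma convex_on_slopes:
  fixes h :: "real \<Rightarrow> real"
  assumes "convex_on S h" "x \<in> S" "z \<in> S" "x < y" "y < z"
  shows "(h y - h x) / (y - x) \<le> (h z - h x) / (z - x)"
    and "(h z - h x) / (z - x) \<le> (h z - h y) / (z - y)"
  using convex_on_slope_le[OF assms]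
  by (metis minus_diff_eq minus_divide_divide)+

text \<open>Slopes from x to points on its right decrease as the point approaches x, and every slope
  from the left bounds them below. The right derivative is therefore their infimum, and both slope
  bounds are properties of that infimum.\<close>

lemma convex_on_right_deriv:
  fixes h :: "real \<Rightarrow> real"
  assumes cvx: "convex_on S h" and S: "open S" and x: "x \<in> S"
  shows convex_on_has_right_deriv: "(h has_real_derivative right_deriv h x) (at_right x)"
    and right_deriv_le_slope: "y \<in> S \<Longrightarrow> x < y \<Longrightarrow> right_deriv h x \<le> (h y - h x) / (y - x)"
    and slope_le_right_deriv: "y \<in> S \<Longrightarrow> y < x \<Longrightarrow> (h x - h y) / (x - y) \<le> right_deriv h x"
proof -
  define q where "q = (\<lambda>y. (h y - h x) / (y - x))"
  define Q where "Q = q ` (S \<inter> {x<..})"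
  obtain e where e: "e > 0" "ball x e \<subseteq> S"
    using S x openE by blast
  have "x - e / 2 \<in> ball x e" "x + e / 2 \<in> ball x e"
    using e(1) by (auto simp: dist_real_def)
  then have zS: "x - e / 2 \<in> S" "x + e / 2 \<in> S"
    using e(2) by auto
  have lower: "(h x - h z) / (x - z) \<le> q y" if "y \<in> S" "x < y" "z \<in> S" "z < x" for y z
    using convex_on_slopes[OF cvx that(3,1,4,2)] unfolding q_def by linarith
  have bdd: "bdd_below Q"
    unfolding Q_def using lower[OF _ _ zS(1)] e(1) by (intro bdd_belowI2) auto
  have ne: "Q \<noteq> {}"
    unfolding Q_def using zS e(1) by auto
  have Inf_le: "Inf Q \<le> q y" if "y \<in> S" "x < y" for y
    using that bdd unfolding Q_def by (intro cInf_lower) auto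
  have evS: "eventually (\<lambda>y. y \<in> S \<and> x < y) (at_right x)"
    using S x by (intro eventually_conj eventually_at_in_open' eventually_at_right_less)
      (auto simp: eventually_at_topological)
  have "(q \<longlongrightarrow> Inf Q) (at_right x)"
  proof (rule order_tendstoI)
    fix a assume "a < Inf Q"
    with evS show "eventually (\<lambda>y. a < q y) (at_right x)"
      by (auto elim!: eventually_mono dest: Inf_le)
  next
    fix a assume "Inf Q < a"
    then obtain z where z: "z \<in> S" "x < z" "q z < a"
      using cInf_less_iff[OF ne bdd] unfolding Q_def by auto
    have "eventually (\<lambda>y. y < z) (at_right x)"
      using z(2) eventually_at_right_field by blast
    with eventually_at_right_less show "eventually (\<lambda>y. q y < a) (at_right x)"
    proof eventually_elim
      case (elim y)
      then show ?case
        using convex_on_slopes(1)[OF cvx x z(1)] z(3) unfolding q_def by force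
    qed
  qed
  then have der: "(h has_real_derivative Inf Q) (at_right x)"
    unfolding has_field_derivative_iff q_def .
  then have eq: "right_deriv h x = Inf Q"
    by (rule right_deriv_eqI)
  show "(h has_real_derivative right_deriv h x) (at_right x)"
    using der eq by simp
  show "right_deriv h x \<le> (h y - h x) / (y - x)" if "y \<in> S" "x < y"
    using Inf_le[OF that] unfolding eq q_def .
  show "(h x - h y) / (x - y) \<le> right_deriv h x" if "y \<in> S" "y < x"
    unfolding eq using ne lower that by (intro cInf_greatest) (auto simp: Q_def)
qed

lemma convex_on_left_deriv:
  fixes h :: "real \<Rightarrow> real"
  assumes cvx: "convex_on S h" and S: "open S" and x: "x \<in> S"
  shows left_deriv_reflect: "left_deriv h x = - right_deriv (\<lambda>t. h (- t)) (- x)"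
    and convex_on_has_left_deriv: "(h has_real_derivative left_deriv h x) (at_left x)"
    and slope_le_left_deriv: "y \<in> S \<Longrightarrow> y < x \<Longrightarrow> (h x - h y) / (x - y) \<le> left_deriv h x"
    and left_deriv_le_slope: "y \<in> S \<Longrightarrow> x < y \<Longrightarrow> left_deriv h x \<le> (h y - h x) / (y - x)"
proof -
  let ?h = "\<lambda>t. h (- t)" and ?S = "uminus ` S"
  have *: "convex_on ?S ?h" "open ?S" "- x \<in> ?S"
    using convex_on_reflect[OF cvx] open_negations[OF S] x by auto
  have "(h has_real_derivative - right_deriv ?h (- x)) (at_left x)"
    unfolding has_real_derivative_at_left_reflect using convex_on_has_right_deriv[OF *] by simp
  then show eq: "left_deriv h x = - right_deriv ?h (- x)"
    and "(h has_real_derivative left_deriv h x) (at_left x)"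
    using left_deriv_eqI by auto
  show "(h x - h y) / (x - y) \<le> left_deriv h x" if "y \<in> S" "y < x"
    using right_deriv_le_slope[OF *, of "- y"] that unfolding eq 
    by (simp add: field_split_simps)
  show "left_deriv h x \<le> (h y - h x) / (y - x)" if "y \<in> S" "x < y"
    using slope_le_right_deriv[OF *, of "- y"] that unfolding eq 
    by (simp add: field_split_simps)
qed

lemma convex_on_left_deriv_le_right_deriv:
  fixes h :: "real \<Rightarrow> real"
  assumes cvx: "convex_on S h" and S: "open S" and x: "x \<in> S"
  shows "left_deriv h x \<le> right_deriv h x"
proof -
  have "((\<lambda>y. (h y - h x) / (y - x)) \<longlongrightarrow> right_deriv h x) (at_right x)"
    using convex_on_has_right_deriv[OF assms] by (simp add: has_field_derivative_iff)
  moreover have "eventually (\<lambda>y. left_deriv h x \<le> (h y - h x) / (y - x)) (at_right x)"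
  proof -
    have "eventually (\<lambda>y. y \<in> S) (at_right x)"
      using S x by (auto simp: eventually_at_topological)
    with eventually_at_right_less show ?thesis
      by eventually_elim (rule left_deriv_le_slope[OF assms])
  qed
  ultimately show ?thesis
    by (intro tendsto_lowerbound) auto
qed

lemma convex_on_right_deriv_le_left_deriv:
  fixes h :: "real \<Rightarrow> real"
  assumes "convex_on S h" "open S" "x \<in> S" "y \<in> S" "x < y"
  shows "right_deriv h x \<le> left_deriv h y"
  using right_deriv_le_slope[OF assms(1,2,3,4,5)] slope_le_left_deriv[OF assms(1,2,4,3,5)]
  by linarith

lemma convex_on_right_deriv_mono:
  fixes h :: "real \<Rightarrow> real"
  assumes "convex_on S h" "open S" "x \<in> S" "y \<in> S" "x \<le> y"
  shows "right_deriv h x \<le> right_deriv h y"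
proof (cases "x = y")
  case False
  then show ?thesis
    using convex_on_right_deriv_le_left_deriv[OF assms(1-4)]
      convex_on_left_deriv_le_right_deriv[OF assms(1,2,4)] assms(5)
    by linarith
qed simp

text \<open>Monotonicity bounds the derivatives near x from below. For the upper bound, some slope
  from x to a fixed z is already below a; by continuity of \<open>h\<close> so is the slope from y
  to z for y close to x, and it dominates the right derivative at y. Left derivatives are squeezed
  in between.\<close>

lemma convex_on_tendsto_right:
  fixes h :: "real \<Rightarrow> real"
  assumes cvx: "convex_on S h" and S: "open S" and x: "x \<in> S"
  shows "(right_deriv h \<longlongrightarrow> right_deriv h x) (at_right x)"
    and "(left_deriv h \<longlongrightarrow> right_deriv h x) (at_right x)"
proof -
  have cont: "continuous_on S h"
    using convex_on_continuous[OF S cvx] .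
  have evS: "eventually (\<lambda>y. y \<in> S) (at_right x)"
    using S x by (auto simp: eventually_at_topological)
  have up: "eventually (\<lambda>y. right_deriv h y < a) (at_right x)" if a: "right_deriv h x < a" for a
  proof -
    have "((\<lambda>y. (h y - h x) / (y - x)) \<longlongrightarrow> right_deriv h x) (at_right x)"
      using convex_on_has_right_deriv[OF assms] by (simp add: has_field_derivative_iff)
    from order_tendstoD(2)[OF this a]
    have "eventually (\<lambda>z. (h z - h x) / (z - x) < a) (at_right x)" .
    then have "eventually (\<lambda>z. (h z - h x) / (z - x) < a \<and> z \<in> S \<and> x < z) (at_right x)"
      using evS eventually_at_right_less by eventually_elim auto
    then obtain z where z: "(h z - h x) / (z - x) < a" "z \<in> S" "x < z"
      using eventually_happens'[OF trivial_limit_at_right_real] by blast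
    have "isCont h x"
      using cont S x continuous_on_eq_continuous_at by blast
    then have "((\<lambda>y. (h z - h y) / (z - y)) \<longlongrightarrow> (h z - h x) / (z - x)) (at_right x)"
      using z(3) by (intro tendsto_intros) (auto simp: continuous_at intro: tendsto_within_subset)
    from order_tendstoD(2)[OF this z(1)]
    have ev: "eventually (\<lambda>y. (h z - h y) / (z - y) < a) (at_right x)" .
    have "eventually (\<lambda>y. y < z) (at_right x)"
      using z(3) eventually_at_right_field by blast
    with ev evS show ?thesis
    proof eventually_elim
      case (elim y)
      then show ?case
        using right_deriv_le_slope[OF cvx S, of y z] z(2) by fastforce
    qed
  qed
  show "(right_deriv h \<longlongrightarrow> right_deriv h x) (at_right x)"
  proof (rule order_tendstoI)
    fix a assume "a < right_deriv h x"
    from evS eventually_at_right_less show "eventually (\<lambda>y. a < right_deriv h y) (at_right x)"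
    proof eventually_elim
      case (elim y)
      then show ?case
        using convex_on_right_deriv_mono[OF assms, of y] \<open>a < _\<close> by fastforce
    qed
  qed (rule up)
  show "(left_deriv h \<longlongrightarrow> right_deriv h x) (at_right x)"
  proof (rule order_tendstoI)
    fix a assume "a < right_deriv h x"
    from evS eventually_at_right_less show "eventually (\<lambda>y. a < left_deriv h y) (at_right x)"
    proof eventually_elim
      case (elim y)
      then show ?case
        using convex_on_right_deriv_le_left_deriv[OF assms, of y] \<open>a < _\<close> by fastforce
    qed
  next
    fix a assume "right_deriv h x < a"
    from evS up[OF this] show "eventually (\<lambda>y. left_deriv h y < a) (at_right x)"
    proof eventually_elim
      case (elim y)
      then show ?case
        using convex_on_left_deriv_le_right_deriv[OF cvx S, of y] by fastforce
    qed
  qed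
qed

lemma convex_on_tendsto_left:
  fixes h :: "real \<Rightarrow> real"
  assumes cvx: "convex_on S h" and S: "open S" and x: "x \<in> S"
  shows "(left_deriv h \<longlongrightarrow> left_deriv h x) (at_left x)"
    and "(right_deriv h \<longlongrightarrow> left_deriv h x) (at_left x)"
proof -
  let ?h = "\<lambda>t. h (- t)" and ?S = "uminus ` S"
  have *: "convex_on ?S ?h" "open ?S" "- x \<in> ?S"
    using convex_on_reflect[OF cvx] open_negations[OF S] x by auto
  have evS: "eventually (\<lambda>y. y \<in> S) (at_left x)"
    using S x by (auto simp: eventually_at_topological)
  have refl: "right_deriv h y = - left_deriv ?h (- y)" if "y \<in> S" for y
    using left_deriv_reflect[OF *(1,2), of "- y"] that by simp
  have L: "(left_deriv ?h \<longlongrightarrow> - left_deriv h x) (at_right (- x))"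
    and R: "(right_deriv ?h \<longlongrightarrow> - left_deriv h x) (at_right (- x))"
    using convex_on_tendsto_right[OF *] left_deriv_reflect[OF assms] by auto
  have "((\<lambda>y. - right_deriv ?h (- y)) \<longlongrightarrow> left_deriv h x) (at_left x)"
    unfolding filterlim_at_left_to_right using tendsto_minus[OF R] by simp
  then show "(left_deriv h \<longlongrightarrow> left_deriv h x) (at_left x)"
    by (rule Lim_transform_eventually)
      (use evS in eventually_elim, simp add: left_deriv_reflect[OF cvx S])
  have "((\<lambda>y. - left_deriv ?h (- y)) \<longlongrightarrow> left_deriv h x) (at_left x)"
    unfolding filterlim_at_left_to_right using tendsto_minus[OF L] by simp
  then show "(right_deriv h \<longlongrightarrow> left_deriv h x) (at_left x)"
    by (rule Lim_transform_eventually) (use evS in eventually_elim, simp add: refl)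
qed

text \<open>On a segment, the gap \<open>d\<close> between chord and function is midpoint concave
  and vanishes at both ends. If its minimum were negative, the leftmost minimiser would be interior,
  and midpoint concavity would produce another minimiser to its left.\<close>

lemma continuous_midpoint_convex_imp_convex_on:
  fixes h :: "'a::real_normed_vector \<Rightarrow> real"
  assumes "convex S" and cont: "continuous_on S h"
    and mid: "\<And>x y. x \<in> S \<Longrightarrow> y \<in> S \<Longrightarrow> h ((1/2) *\<^sub>R (x + y)) \<le> (h x + h y) / 2"
  shows "convex_on S h"
proof (rule convex_onI)
  fix t x y assume t: "0 < (t::real)" "t < 1" and xy: "x \<in> S" "y \<in> S"
  define l where "l = (\<lambda>s. (1 - s) *\<^sub>R x + s *\<^sub>R y)"
  define d where "d = (\<lambda>s. (1 - s) * h x + s * h y - h (l s))"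
  have lS: "l s \<in> S" if "s \<in> {0..1}" for s
    using that \<open>convex S\<close> xy unfolding l_def convex_alt by auto
  have "continuous_on {0..1} l"
    unfolding l_def by (intro continuous_intros)
  then have dcont: "continuous_on {0..1} d"
    unfolding d_def using lS
    by (intro continuous_intros continuous_on_compose2[OF cont]) auto
  have dmid: "(d r + d s) / 2 \<le> d ((r + s) / 2)" if "r \<in> {0..1}" "s \<in> {0..1}" for r s
  proof -
    have "l ((r + s) / 2) = (1/2) *\<^sub>R (l r + l s)"
      unfolding l_def by (simp add: algebra_simps flip: scaleR_add_left)
    then show ?thesis
      using mid[OF lS lS, of r s] that unfolding d_def by (simp add: field_simps)
  qed
  obtain m where m: "m \<in> {0..1}" "\<And>s. s \<in> {0..1} \<Longrightarrow> d m \<le> d s"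
    using continuous_attains_inf[OF _ _ dcont] by auto
  define M where "M = {0..1} \<inter> d -` {d m}"
  have "closed M"
    unfolding M_def by (rule continuous_closed_preimage[OF dcont]) auto
  moreover have "m \<in> M" "bdd_below M"
    unfolding M_def using m(1) by auto
  ultimately have Inf: "Inf M \<in> M"
    using closed_contains_Inf by blast
  define a where "a = Inf M"
  have a: "a \<in> {0..1}" "d a = d m" "\<And>s. s \<in> M \<Longrightarrow> a \<le> s"
    using Inf cInf_lower[OF _ \<open>bdd_below M\<close>] unfolding a_def M_def by auto
  have end0: "d 0 = 0" "d 1 = 0"
    unfolding d_def l_def by auto
  have "d a \<ge> 0"
  proof (rule ccontr)
    assume neg: "\<not> d a \<ge> 0"
    then have a01: "0 < a" "a < 1"
      using end0 a(1) by (metis atLeastAtMost_iff less_le order_refl)+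
    define r where "r = min a (1 - a)"
    have r: "r > 0" "a - r \<in> {0..1}" "a + r \<in> {0..1}"
      using a01 unfolding r_def by auto
    have "(d (a - r) + d (a + r)) / 2 \<le> d a"
      using dmid[OF r(2,3)] by simp
    with m(2)[OF r(2)] m(2)[OF r(3)] a(2) have "d (a - r) = d m"
      by simp
    then have "a - r \<in> M"
      using r(2) unfolding M_def by simp
    with a(3) r(1) show False by fastforce
  qed
  then have "d t \<ge> 0"
    using m(2)[of t] t a(2) by simp
  then show "h ((1 - t) *\<^sub>R x + t *\<^sub>R y) \<le> (1 - t) * h x + t * h y"
    unfolding d_def l_def by simp
qed fact

text \<open>A last-point argument replaces the mean value theorem. If \<open>h b\<close> exceeded
  \<open>h a\<close>, tilt \<open>h\<close> by a positive slope \<open>e\<close> below its average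
  slope and take the last point \<open>c\<close> where the tilted function is nonpositive. Right
  after \<open>c\<close> it is positive, so its right derivative \<open>d - e\<close> at
  \<open>c\<close> could not be negative.\<close>

lemma right_deriv_nonpos_imp_nonincreasing:
  fixes h :: "real \<Rightarrow> real"
  assumes "a \<le> b" and cont: "continuous_on {a..b} h"
    and der: "\<And>t. a \<le> t \<Longrightarrow> t < b \<Longrightarrow> \<exists>d\<le>0. (h has_real_derivative d) (at_right t)"
  shows "h b \<le> h a"
proof (rule ccontr)
  assume "\<not> h b \<le> h a"
  then have less: "h a < h b" and ab: "a < b"
    using \<open>a \<le> b\<close> by (auto simp: less_le)
  have "0 < (h b - h a) / (b - a)"
    using less ab by simp
  then obtain e where "0 < e" "e < (h b - h a) / (b - a)"
    using dense by blast
  then have e: "e > 0" "e * (b - a) < h b - h a"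
    using ab by (simp_all add: pos_less_divide_eq)
  define k where "k = (\<lambda>t. h t - h a - e * (t - a))"
  have kcont: "continuous_on {a..b} k"
    unfolding k_def by (intro continuous_intros cont)
  define M where "M = {a..b} \<inter> k -` {..0}"
  have "closed M"
    unfolding M_def by (rule continuous_closed_preimage[OF kcont]) auto
  moreover have "a \<in> M" "bdd_above M"
    unfolding M_def k_def using ab by auto
  ultimately have Sup: "Sup M \<in> M"
    using closed_contains_Sup by blast
  define c where "c = Sup M"
  have c: "a \<le> c" "c \<le> b" "k c \<le> 0" "\<And>s. s \<in> M \<Longrightarrow> s \<le> c"
    using Sup cSup_upper[OF _ \<open>bdd_above M\<close>] unfolding c_def M_def by auto
  have "k b > 0"
    using e unfolding k_def by simp
  with c have cb: "c < b"
    by (metis less_le not_less)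
  obtain d where d: "d \<le> 0" "(h has_real_derivative d) (at_right c)"
    using der c(1) cb by blast
  have "(k has_real_derivative d - e) (at_right c)"
    unfolding k_def by (auto intro!: derivative_eq_intros d(2))
  then have lim: "((\<lambda>t. (k t - k c) / (t - c)) \<longlongrightarrow> d - e) (at_right c)"
    by (simp add: has_field_derivative_iff)
  have "eventually (\<lambda>t. t < b) (at_right c)"
    using cb eventually_at_right_field by blast
  with eventually_at_right_less have "eventually (\<lambda>t. 0 \<le> (k t - k c) / (t - c)) (at_right c)"
  proof eventually_elim
    case (elim t)
    then have "\<not> k t \<le> 0"
      using c(1) c(4)[of t] unfolding M_def by force
    then show ?case
      using elim c(3) by simp
  qed
  then have "0 \<le> d - e"
    using lim by (intro tendsto_lowerbound) auto
  with d(1) e(1) show False by simp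
qed

section \<open>One-sided derivatives and limits along a moving point\<close>

lemma has_real_derivative_right_quotient:
  fixes h :: "real \<Rightarrow> real"
  assumes "(h has_real_derivative d) (at_right x)" "c > 0"
  shows "((\<lambda>t. (h (x + c * t) - h x) / t) \<longlongrightarrow> c * d) (at_right 0)"
proof -
  have "((\<lambda>y. (h y - h x) / (y - x)) \<longlongrightarrow> d) (at_right x)"
    using assms(1) by (simp add: has_field_derivative_iff)
  moreover have "filterlim (\<lambda>t. x + c * t) (at_right x) (at_right 0)"
    unfolding filterlim_at using assms(2)
    by (auto intro!: tendsto_eq_intros simp: eventually_at_filter)
  ultimately have "((\<lambda>t. (h (x + c * t) - h x) / (x + c * t - x)) \<longlongrightarrow> d) (at_right 0)"
    by (rule filterlim_compose)
  then have "((\<lambda>t. c * ((h (x + c * t) - h x) / (x + c * t - x))) \<longlongrightarrow> c * d) (at_right 0)"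
    by (intro tendsto_intros)
  then show ?thesis
    using assms(2) by simp
qed

lemma has_real_derivative_left_quotient:
  fixes h :: "real \<Rightarrow> real"
  assumes "(h has_real_derivative d) (at_left x)" "c > 0"
  shows "((\<lambda>t. (h x - h (x - c * t)) / t) \<longlongrightarrow> c * d) (at_right 0)"
  using has_real_derivative_right_quotient[OF assms(1)[unfolded has_real_derivative_at_left_reflect] assms(2)]
    tendsto_minus_cancel_left[of "\<lambda>t. (h (- (- x + c * t)) - h x) / t" "c * d"]
  by (simp add: minus_divide_left)

lemma eventually_at_left_pos: "0 < x \<Longrightarrow> eventually (\<lambda>y::real. 0 < y) (at_left x)"
  using eventually_at_left_field by blast

lemma eventually_at_right_pos: "0 < x \<Longrightarrow> eventually (\<lambda>y::real. 0 < y) (at_right x)"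
  using eventually_at_right_less[of x] by (rule eventually_mono) simp

text \<open>The inner function may approach \<open>z t\<close> from either side, and from both when
  C = 0. Hence \<open>k\<close> is expanded on both sides at once: a piecewise linear part
  \<open>q\<close> plus a remainder \<open>e w * \<bar>w\<bar>\<close> with \<open>e\<close> tending
  to 0. For C = 0 the choice of branch is immaterial because of the factor C.\<close>

lemma has_real_derivative_right_chain:
  fixes k z :: "real \<Rightarrow> real"
  assumes R: "(k has_real_derivative r) (at_right (z t))"
    and L: "(k has_real_derivative l) (at_left (z t))"
    and z: "DERIV z t :> C"
  shows "((\<lambda>t. k (z t)) has_real_derivative (if 0 \<le> C then r else l) * C) (at_right t)"
proof -
  define q where "q = (\<lambda>w. r * max w 0 + l * min w 0)"
  \<comment> \<open>Division by zero gives \<open>e 0 = 0\<close>, which is the value that makes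
    \<open>e\<close> continuous at 0.\<close>
  define e where "e = (\<lambda>w. (k (z t + w) - k (z t) - q w) / \<bar>w\<bar>)"
  have e: "k (z t + w) - k (z t) = e w * \<bar>w\<bar> + q w" for w
    unfolding e_def q_def by (cases "w = 0") auto
  have "((\<lambda>w. (k (z t + 1 * w) - k (z t)) / w - r) \<longlongrightarrow> 1 * r - r) (at_right 0)"
    by (intro tendsto_intros has_real_derivative_right_quotient R) auto
  moreover have "eventually (\<lambda>w. (k (z t + 1 * w) - k (z t)) / w - r = e w) (at_right 0)"
    using eventually_at_right_less
    by eventually_elim (simp add: e_def q_def diff_divide_distrib)
  ultimately have "(e \<longlongrightarrow> 1 * r - r) (at_right 0)"
    by (rule Lim_transform_eventually)
  moreover have "((\<lambda>w. l - (k (z t) - k (z t - 1 * w)) / w) \<longlongrightarrow> l - 1 * l) (at_right 0)"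
    by (intro tendsto_intros has_real_derivative_left_quotient L) auto
  moreover have "eventually (\<lambda>w. l - (k (z t) - k (z t - 1 * w)) / w = e (- w)) (at_right 0)"
    using eventually_at_right_less
    by eventually_elim (simp add: e_def q_def diff_divide_distrib add_divide_distrib)
  ultimately have "(e \<longlongrightarrow> 0) (at_right 0)" "((\<lambda>w. e (- w)) \<longlongrightarrow> 0) (at_right 0)"
    using Lim_transform_eventually by force+
  then have "(e \<longlongrightarrow> 0) (at 0)"
    using filterlim_at_left_to_right[of e "nhds 0" 0] by (intro filterlim_split_at) simp_all
  then have cont_e: "isCont e 0"
    unfolding isCont_def by (simp add: e_def)
  have zlim: "((\<lambda>s. (z s - z t) / (s - t)) \<longlongrightarrow> C) (at_right t)"
    using z by (auto simp: has_field_derivative_iff intro: tendsto_within_subset)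
  have "isCont z t"
    using z by (rule DERIV_isCont)
  then have "(z \<longlongrightarrow> z t) (at_right t)"
    unfolding isCont_def by (rule tendsto_within_subset) simp
  then have "((\<lambda>s. z s - z t) \<longlongrightarrow> 0) (at_right t)"
    by (simp add: LIM_zero)
  then have "((\<lambda>s. e (z s - z t)) \<longlongrightarrow> e 0) (at_right t)"
    by (rule isCont_tendsto_compose[OF cont_e])
  then have "((\<lambda>s. e (z s - z t) * \<bar>(z s - z t) / (s - t)\<bar> + q ((z s - z t) / (s - t)))
      \<longlongrightarrow> e 0 * \<bar>C\<bar> + q C) (at_right t)"
    unfolding q_def by (intro tendsto_intros zlim)
  moreover have "eventually (\<lambda>s. e (z s - z t) * \<bar>(z s - z t) / (s - t)\<bar> + q ((z s - z t) / (s - t))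
      = (k (z s) - k (z t)) / (s - t)) (at_right t)"
    using eventually_at_right_less
  proof eventually_elim
    case (elim s)
    \<comment> \<open>\<open>q\<close> is positively homogeneous, so dividing by s - t > 0 commutes
      with it.\<close>
    have "q ((z s - z t) / (s - t)) = q (z s - z t) / (s - t)"
      using elim unfolding q_def
      by (simp add: max_def min_def divide_le_0_iff zero_le_divide_iff)
    then show ?case
      using e[of "z s - z t"] elim by (simp add: add_divide_distrib)
  qed
  ultimately have "((\<lambda>s. (k (z s) - k (z t)) / (s - t)) \<longlongrightarrow> e 0 * \<bar>C\<bar> + q C) (at_right t)"
    by (rule Lim_transform_eventually)
  moreover have "e 0 * \<bar>C\<bar> + q C = (if 0 \<le> C then r else l) * C"
    unfolding e_def q_def by simp
  ultimately show ?thesis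
    unfolding has_field_derivative_iff by simp
qed

text \<open>A nonzero velocity makes a moving point leave its position toward one definite side, so
  one-sided limits can be composed with the motion.\<close>

lemma DERIV_pos_filterlim_at_right:
  fixes z :: "real \<Rightarrow> real"
  assumes "DERIV z t :> C" "0 < C"
  shows "filterlim z (at_right (z t)) (at_right t)"
  unfolding filterlim_at
proof
  have "isCont z t"
    using assms(1) by (rule DERIV_isCont)
  then show "(z \<longlongrightarrow> z t) (at_right t)"
    unfolding isCont_def by (rule tendsto_within_subset) simp
  obtain d where d: "0 < d" "\<And>h. 0 < h \<Longrightarrow> h < d \<Longrightarrow> z t < z (t + h)"
    using DERIV_pos_inc_right[OF assms] by blast
  have "eventually (\<lambda>s. s < t + d) (at_right t)"
    using d(1) eventually_at_right_field[of _ t] by (metis less_add_same_cancel1)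
  with eventually_at_right_less show "eventually (\<lambda>s. z s \<in> {z t<..} \<and> z s \<noteq> z t) (at_right t)"
  proof eventually_elim
    case (elim s)
    then show ?case
      using d(2)[of "s - t"] by simp
  qed
qed

lemma DERIV_neg_filterlim_at_left:
  fixes z :: "real \<Rightarrow> real"
  assumes "DERIV z t :> C" "C < 0"
  shows "filterlim z (at_left (z t)) (at_right t)"
proof -
  have "filterlim (\<lambda>s. - z s) (at_right (- z t)) (at_right t)"
    using assms by (intro DERIV_pos_filterlim_at_right[of "\<lambda>s. - z s"]) (auto intro!: derivative_eq_intros)
  moreover have "filterlim uminus (at_left (z t)) (at_right (- z t))"
    unfolding at_left_minus filterlim_def by simp
  ultimately have "filterlim (\<lambda>s. - (- z s)) (at_left (z t)) (at_right t)"
    by (rule filterlim_compose[rotated])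
  then show ?thesis
    by simp
qed

section \<open>Subadditive means and concavity\<close>

locale mean_generator =
  fixes f :: "real \<Rightarrow> real"
  assumes cont: "continuous_on {0<..} f"
    and smono: "strict_mono_on {0<..} f"
begin

abbreviation g where "g \<equiv> inv_into {0<..} f"
abbreviation J where "J \<equiv> f ` {0<..}"

lemma f_less [simp]: "0 < x \<Longrightarrow> 0 < y \<Longrightarrow> f x < f y \<longleftrightarrow> x < y"
  using smono by (simp add: strict_mono_on_less)

lemma f_le [simp]: "0 < x \<Longrightarrow> 0 < y \<Longrightarrow> f x \<le> f y \<longleftrightarrow> x \<le> y"
  using f_less by (meson linorder_not_le)

lemma inj: "inj_on f {0<..}"
  using smono strict_mono_on_imp_inj_on by blast

lemma g_f [simp]: "0 < x \<Longrightarrow> g (f x) = x"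
  using inj by simp

lemma f_g [simp]: "u \<in> J \<Longrightarrow> f (g u) = u"
  by (rule f_inv_into_f)

lemma g_pos [simp]: "u \<in> J \<Longrightarrow> 0 < g u"
  using inv_into_into[of u f "{0<..}"] by simp

lemma open_J: "open J"
  using invariance_of_domain[OF cont _ inj] by simp

lemma convex_J: "convex J"
  using connected_continuous_image[OF cont] connected_convex_1 by blast

lemma convex_JJ: "convex (J \<times> J)"
  by (intro convex_Times convex_J)

lemma J_segment: "u \<in> J \<Longrightarrow> v \<in> J \<Longrightarrow> 0 \<le> t \<Longrightarrow> t \<le> 1 \<Longrightarrow> u + t * (v - u) \<in> J"
  using convex_J unfolding convex_alt by (force simp: algebra_simps)

lemma J_midpoint: "u \<in> J \<Longrightarrow> v \<in> J \<Longrightarrow> (u + v) / 2 \<in> J"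
  using J_segment[of u v "1/2"] by (simp add: field_simps)

lemma cont_g: "continuous_on J g"
  by (rule continuous_on_inverse_open[OF _ cont]) auto

lemma continuous_on_Phi: "continuous_on (J \<times> J) (Phi f)"
  unfolding Phi_def case_prod_unfold
  by (intro continuous_on_compose2[OF cont] continuous_intros continuous_on_compose2[OF cont_g])
    (auto simp: add_pos_pos)

text \<open>Applying f to subadditivity at (x1, x2) and (y1, y2) gives the midpoint inequality for
  \<Phi> at (f x1, f y1) and (f x2, f y2); continuity of \<Phi> extends it to all weights.\<close>

lemma subadditive_imp_concave_Phi:
  assumes "subadditive_pos 2 (quasi_arith_mean f 2)"
  shows "concave_on (J \<times> J) (Phi f)"
  unfolding concave_on_def
proof (rule continuous_midpoint_convex_imp_convex_on[OF convex_JJ])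
  show "continuous_on (J \<times> J) (\<lambda>x. - Phi f x)"
    using continuous_on_Phi by (intro continuous_intros)
next
  fix P Q assume "P \<in> J \<times> J" "Q \<in> J \<times> J"
  then obtain x1 y1 x2 y2 where pos: "0 < x1" "0 < y1" "0 < x2" "0 < y2"
    and PQ: "P = (f x1, f y1)" "Q = (f x2, f y2)"
    by auto
  define m where "m = (f (x1 + y1) + f (x2 + y2)) / 2"
  define mx where "mx = (f x1 + f x2) / 2"
  define my where "my = (f y1 + f y2) / 2"
  have J: "m \<in> J" "mx \<in> J" "my \<in> J"
    using pos unfolding m_def mx_def my_def by (auto intro!: J_midpoint)
  have two: "(\<Sum>i=1..2. h i) = h 1 + h 2" for h :: "nat \<Rightarrow> real"
    by (simp add: numeral_2_eq_2)
  have "g m \<le> g mx + g my"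
    using assms[unfolded subadditive_pos_def, rule_format,
        of "\<lambda>i. if i = 1 then x1 else x2" "\<lambda>i. if i = 1 then y1 else y2"] pos
    unfolding quasi_arith_mean_def two m_def mx_def my_def by simp
  then have "f (g m) \<le> f (g mx + g my)"
    using J by (subst f_le) (auto simp: add_pos_pos)
  then have "m \<le> f (g mx + g my)"
    using J by simp
  moreover have "Phi f ((1/2) *\<^sub>R (P + Q)) = f (g mx + g my)"
    unfolding PQ Phi_def mx_def my_def by simp
  moreover have "Phi f P = f (x1 + y1)" "Phi f Q = f (x2 + y2)"
    unfolding PQ Phi_def using pos by simp_all
  ultimately show "- Phi f ((1/2) *\<^sub>R (P + Q)) \<le> (- Phi f P + - Phi f Q) / 2"
    unfolding m_def by simp
qed

text \<open>Jensen's inequality with equal weights at the points (f (x i), f (y i)), where \<Phi>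
  takes the values f (x i + y i).\<close>

lemma concave_Phi_imp_subadditive:
  assumes conc: "concave_on (J \<times> J) (Phi f)" and n: "n \<ge> 1"
  shows "subadditive_pos n (quasi_arith_mean f n)"
  unfolding subadditive_pos_def
proof (intro allI impI)
  fix x y :: "nat \<Rightarrow> real"
  assume xy: "\<forall>i\<in>{1..n}. 0 < x i \<and> 0 < y i"
  define M where "M = (\<lambda>z. (\<Sum>i=1..n. f (z i)) / real n)"
  have M_eq: "M z = (\<Sum>i=1..n. (1 / real n) *\<^sub>R f (z i))" for z
    unfolding M_def by (simp add: sum_divide_distrib)
  have w: "(\<Sum>i=1..n. 1 / real n) = 1"
    using n by simp
  have MJ: "M z \<in> J" if "\<And>i. i \<in> {1..n} \<Longrightarrow> 0 < z i" for z
    unfolding M_eq using that n by (intro convex_sum[OF _ convex_J w]) auto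
  have J: "M x \<in> J" "M y \<in> J" "M (\<lambda>i. x i + y i) \<in> J"
    using xy by (auto intro!: MJ add_pos_pos)
  have "(\<Sum>i=1..n. 1 / real n * Phi f (f (x i), f (y i)))
      \<le> Phi f (\<Sum>i=1..n. (1 / real n) *\<^sub>R (f (x i), f (y i)))"
    using n xy by (intro concave_on_sum[OF _ _ conc w]) auto
  also have "(\<Sum>i=1..n. (1 / real n) *\<^sub>R (f (x i), f (y i))) = (M x, M y)"
    unfolding M_eq by (simp add: prod_eq_iff fst_sum snd_sum)
  also have "(\<Sum>i=1..n. 1 / real n * Phi f (f (x i), f (y i))) = M (\<lambda>i. x i + y i)"
    unfolding M_eq using xy by (intro sum.cong) (auto simp: Phi_def)
  finally have "f (g (M (\<lambda>i. x i + y i))) \<le> f (g (M x) + g (M y))"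
    using J by (simp add: Phi_def)
  then have "g (M (\<lambda>i. x i + y i)) \<le> g (M x) + g (M y)"
    using J by (subst (asm) f_le) (auto simp: add_pos_pos)
  then show "quasi_arith_mean f n (\<lambda>i. x i + y i) \<le> quasi_arith_mean f n x + quasi_arith_mean f n y"
    unfolding quasi_arith_mean_def M_def .
qed

text \<open>The midpoint inequality with slack: since f increases, x and y may be any upper
  estimates of the two f-means. This suits situations where those means are known only to first
  order.\<close>

lemma concave_Phi_midpoint:
  assumes conc: "concave_on (J \<times> J) (Phi f)"
    and pos: "0 < x1" "0 < y1" "0 < x2" "0 < y2" "0 < x" "0 < y"
    and mid: "(f x1 + f x2) / 2 \<le> f x" "(f y1 + f y2) / 2 \<le> f y"
  shows "(f (x1 + y1) + f (x2 + y2)) / 2 \<le> f (x + y)"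
proof -
  define mx where "mx = (f x1 + f x2) / 2"
  define my where "my = (f y1 + f y2) / 2"
  have J: "mx \<in> J" "my \<in> J"
    using pos unfolding mx_def my_def by (auto intro!: J_midpoint)
  have "(1/2) * Phi f (f x1, f y1) + (1/2) * Phi f (f x2, f y2)
      \<le> Phi f ((1/2) *\<^sub>R (f x1, f y1) + (1/2) *\<^sub>R (f x2, f y2))"
    using pos by (intro conc[unfolded concave_on_iff, THEN conjunct2, rule_format]) auto
  also have "(1/2) *\<^sub>R (f x1, f y1) + (1/2) *\<^sub>R (f x2, f y2) = (mx, my)"
    unfolding mx_def my_def by simp
  finally have "(f (x1 + y1) + f (x2 + y2)) / 2 \<le> f (g mx + g my)"
    using pos by (simp add: Phi_def)
  also have "g mx \<le> x" "g my \<le> y"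
    using f_le[OF g_pos[OF J(1)] pos(5)] f_le[OF g_pos[OF J(2)] pos(6)] J mid
    unfolding mx_def my_def by simp_all
  then have "f (g mx + g my) \<le> f (x + y)"
    using J pos by (subst f_le) (auto simp: add_pos_pos)
  finally show ?thesis .
qed

text \<open>Both mirror points have the value f (x + y), and their midpoint lies on the diagonal, so
  x + y is at most twice the f-mean of x and y. That the arithmetic mean stays below the f-mean is
  midpoint convexity of the increasing f.\<close>

lemma concave_Phi_imp_convex:
  assumes conc: "concave_on (J \<times> J) (Phi f)"
  shows "convex_on {0<..} f"
proof (rule continuous_midpoint_convex_imp_convex_on[OF _ cont])
  fix x y :: real
  assume xy: "x \<in> {0<..}" "y \<in> {0<..}"
  define m where "m = (f x + f y) / 2"
  have m: "m \<in> J"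
    unfolding m_def using xy by (intro J_midpoint) auto
  have "(f (x + y) + f (y + x)) / 2 \<le> f (g m + g m)"
    using xy m by (intro concave_Phi_midpoint[OF conc]) (auto simp: m_def)
  then have "f (x + y) \<le> f (g m + g m)"
    by (simp add: add.commute)
  then have "x + y \<le> g m + g m"
    using xy m by (subst (asm) f_le) (auto simp: add_pos_pos)
  then have "f ((x + y) / 2) \<le> f (g m)"
    using xy g_pos[OF m] by (subst f_le) auto
  then show "f ((1/2) *\<^sub>R (x + y)) \<le> (f x + f y) / 2"
    using m by (simp add: m_def)
qed simp

text \<open>A kink of \<open>f\<close> at \<open>2 * x\<close> would make \<open>\<Phi>\<close> fail concavity at \<open>(f x, f x)\<close> in the direction
  of the level curve through that point: compare \<open>(f (x + t), f x)\<close> and \<open>(f x, f (x - t))\<close>.\<close>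

lemma concave_Phi_imp_DERIV:
  assumes conc: "concave_on (J \<times> J) (Phi f)" and s: "0 < s"
  shows "DERIV f s :> right_deriv f s" "0 < right_deriv f s"
proof -
  note cvx = concave_Phi_imp_convex[OF conc] and op = open_greaterThan[of "0::real"]
  \<comment> \<open>The slope over [z / 2, z] is positive by strict monotonicity and bounds the left
    derivative at z from below by convexity.\<close>
  have left_pos: "0 < left_deriv f z" if "0 < z" for z
  proof -
    have "0 < (f z - f (z / 2)) / (z - z / 2)"
      using that by simp
    also have "\<dots> \<le> left_deriv f z"
      using that by (intro slope_le_left_deriv[OF cvx op]) auto
    finally show ?thesis .
  qed
  have right_pos: "0 < right_deriv f z" if "0 < z" for z
    using left_pos[OF that] convex_on_left_deriv_le_right_deriv[OF cvx op, of z] that by simp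
  define x where "x = s / 2"
  have x: "0 < x" "x \<in> {0<..}" "s \<in> {0<..}" and s_eq: "s = x + x"
    using s by (auto simp: x_def)
  define a where "a = right_deriv f x"
  define b where "b = left_deriv f x"
  define D where "D = right_deriv f s"
  define E where "E = left_deriv f s"
  have ab: "a > 0" "b > 0" "D > 0"
    unfolding a_def b_def D_def using left_pos right_pos x(1) s by auto
  note R = has_real_derivative_right_quotient[OF convex_on_has_right_deriv[OF cvx op]]
    and L = has_real_derivative_left_quotient[OF convex_on_has_left_deriv[OF cvx op]]
  \<comment> \<open>To first order the f-means of x + t, x and of x, x - t are x + t / 2 and x - t /
    2. Enlarging each by e t / 2 turns this into true inequalities for small t, because a, b > 0.
    The enlarged means add up to s + e t, which is where the error term \<open>e * D\<close> comes
    from.\<close>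
  have ineq: "D - E \<le> 2 * (e * D)" if e: "0 < e" "e < 1" for e
  proof -
    have "((\<lambda>t. (f (x + (1 + e) / 2 * t) - f x) / t - (f (x + 1 * t) - f x) / t / 2)
        \<longlongrightarrow> (1 + e) / 2 * a - 1 * a / 2) (at_right 0)"
      unfolding a_def using e by (intro tendsto_intros R x) auto
    moreover have "(1 + e) / 2 * a - 1 * a / 2 > 0"
      using e ab by (simp add: field_simps)
    ultimately have ev1: "eventually (\<lambda>t. (f (x + (1 + e) / 2 * t) - f x) / t
        - (f (x + 1 * t) - f x) / t / 2 > 0) (at_right 0)"
      by (rule order_tendstoD(1))
    have "((\<lambda>t. (f x - f (x - 1 * t)) / t / 2 - (f x - f (x - (1 - e) / 2 * t)) / t)
        \<longlongrightarrow> 1 * b / 2 - (1 - e) / 2 * b) (at_right 0)"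
      unfolding b_def using e by (intro tendsto_intros L x) auto
    moreover have "1 * b / 2 - (1 - e) / 2 * b > 0"
      using e ab by (simp add: field_simps)
    ultimately have ev2: "eventually (\<lambda>t. (f x - f (x - 1 * t)) / t / 2
        - (f x - f (x - (1 - e) / 2 * t)) / t > 0) (at_right 0)"
      by (rule order_tendstoD(1))
    have "eventually (\<lambda>t. t < x) (at_right 0)"
      using x(1) eventually_at_right_field by blast
    with ev1 ev2 have "eventually (\<lambda>t. (f (s + 1 * t) - f s) / t - (f s - f (s - 1 * t)) / t
        \<le> 2 * ((f (s + e * t) - f s) / t)) (at_right 0)"
      using eventually_at_right_less
    proof eventually_elim
      case (elim t)
      then have t: "0 < t" "t < x"
        by auto
      have cancel1: "B / 2 < A" if "A / t - B / t / 2 > 0" for A B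
        using that t(1) by (simp add: field_simps)
      have cancel2: "A < B / 2" if "B / t / 2 - A / t > 0" for A B
        using that t(1) by (simp add: field_simps)
      have "0 < x - (1 - e) / 2 * t"
      proof -
        have "(1 - e) / 2 * t \<le> 1 * t"
          using e t by (intro mult_right_mono) auto
        with t show ?thesis by linarith
      qed
      moreover have "0 < x + (1 + e) / 2 * t"
        using x(1) e t by (intro add_pos_pos mult_pos_pos) auto
      moreover have "(f (x + t) + f x) / 2 \<le> f (x + (1 + e) / 2 * t)"
        using cancel1[OF elim(1)] by simp
      moreover have "(f x + f (x - t)) / 2 \<le> f (x - (1 - e) / 2 * t)"
        using cancel2[OF elim(2)] by simp
      ultimately have "(f (x + t + x) + f (x + (x - t))) / 2
          \<le> f (x + (1 + e) / 2 * t + (x - (1 - e) / 2 * t))"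
        using x t by (intro concave_Phi_midpoint[OF conc]) auto
      also have "x + (1 + e) / 2 * t + (x - (1 - e) / 2 * t) = s + e * t"
        unfolding s_eq by (simp add: field_simps)
      finally have "f (s + t) + f (s - t) \<le> 2 * f (s + e * t)"
        unfolding s_eq by (simp add: algebra_simps)
      then have "(f (s + t) - f s - (f s - f (s - t))) / t \<le> (2 * (f (s + e * t) - f s)) / t"
        using t(1) by (intro divide_right_mono) auto
      then show ?case
        by (simp add: diff_divide_distrib add_divide_distrib)
    qed
    moreover have "((\<lambda>t. (f (s + 1 * t) - f s) / t - (f s - f (s - 1 * t)) / t)
        \<longlongrightarrow> 1 * D - 1 * E) (at_right 0)"
      unfolding D_def E_def by (intro tendsto_intros L R x) auto
    moreover have "((\<lambda>t. 2 * ((f (s + e * t) - f s) / t)) \<longlongrightarrow> 2 * (e * D)) (at_right 0)"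
      unfolding D_def using e by (intro tendsto_intros R x) auto
    ultimately have "1 * D - 1 * E \<le> 2 * (e * D)"
      by (intro tendsto_le[OF trivial_limit_at_right_real])
    then show ?thesis by simp
  qed
  have "D \<le> E"
  proof (rule ccontr)
    assume "\<not> D \<le> E"
    \<comment> \<open>Any e below (D - E) / (2 D) makes 2 e D smaller than D - E, against
      \<open>ineq\<close>.\<close>
    then have pos: "0 < min 1 ((D - E) / (2 * D))"
      using ab by simp
    then obtain e where "0 < e" "e < min 1 ((D - E) / (2 * D))"
      using dense by blast
    then show False
      using ineq[of e] ab(3) by (simp add: field_simps)
  qed
  moreover have "E \<le> D"
    unfolding D_def E_def by (rule convex_on_left_deriv_le_right_deriv[OF cvx op x(3)])
  ultimately have "D = E" by simp
  then show "DERIV f s :> right_deriv f s"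
    using convex_on_has_right_deriv[OF cvx op x(3)] convex_on_has_left_deriv[OF cvx op x(3)]
    unfolding D_def E_def has_field_derivative_iff by (intro filterlim_split_at) simp_all
  show "0 < right_deriv f s"
    using right_pos s by simp
qed


lemma concave_Phi_imp_differentiable:
  assumes "concave_on (J \<times> J) (Phi f)"
  shows "differentiable_pos_deriv f"
  unfolding differentiable_pos_deriv_def
proof (intro allI impI)
  fix x :: real assume "0 < x"
  note D = concave_Phi_imp_DERIV[OF assms this]
  show "f differentiable (at x) \<and> 0 < deriv f x"
    using D DERIV_imp_deriv[OF D(1)] real_differentiable_def by auto
qed

end

section \<open>Tangent planes of \<Phi> and subadditivity of \<Psi>\<close>

locale smooth_generator = mean_generator +
  assumes diff: "differentiable_pos_deriv f"
begin

abbreviation p where "p \<equiv> deriv f"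

lemma DERIV_f: "0 < x \<Longrightarrow> DERIV f x :> p x"
  using diff unfolding differentiable_pos_deriv_def
  by (metis DERIV_deriv_iff_real_differentiable)

lemma p_pos [simp]: "0 < x \<Longrightarrow> 0 < p x"
  using diff unfolding differentiable_pos_deriv_def by blast

lemma DERIV_g:
  assumes "u \<in> J"
  shows "DERIV g u :> inverse (p (g u))"
proof -
  obtain a b where ab: "a < u" "u < b" "{a<..<b} \<subseteq> J"
  proof -
    obtain e where "e > 0" "ball u e \<subseteq> J"
      using open_J assms openE by blast
    then show ?thesis
      by (intro that[of "u - e" "u + e"]) (auto simp: ball_eq_greaterThanLessThan)
  qed
  show ?thesis
  proof (rule DERIV_inverse_function[OF DERIV_f _ ab(1,2)])
    show "0 < g u"
      using assms by simp
    then have "0 < p (g u)"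
      by simp
    then show "p (g u) \<noteq> 0"
      by linarith
    show "isCont g u"
      using cont_g open_J assms continuous_on_eq_continuous_at by blast
  qed (use ab(3) in auto)
qed

lemma DERIV_g_line:
  assumes "u + t * a \<in> J"
  shows "DERIV (\<lambda>t. g (u + t * a)) t :> a / p (g (u + t * a))"
proof -
  have "DERIV (\<lambda>t. u + t * a) t :> a"
    by (auto intro!: derivative_eq_intros)
  from DERIV_chain2[where f = g, OF DERIV_g[OF assms] this] show ?thesis
    by (simp add: field_simps)
qed

lemma DERIV_Phi_line:
  assumes "u + t * a \<in> J" "v + t * b \<in> J"
  defines "x \<equiv> g (u + t * a)" and "y \<equiv> g (v + t * b)"
  shows "DERIV (\<lambda>t. f (g (u + t * a) + g (v + t * b))) t :> p (x + y) * (a / p x + b / p y)"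
  unfolding x_def y_def
  by (rule DERIV_chain2[OF DERIV_f]) (use assms in \<open>auto intro!: add_pos_pos DERIV_add DERIV_g_line\<close>)

text \<open>The gradient of \<Phi> at (f x, f y) is p (x + y) times (1 / p x, 1 / p y). Dividing the
  tangent inequality by p (x + y) turns each of its three differences into a value of
  \<Psi>.\<close>

lemma concave_Phi_imp_Psi:
  assumes conc: "concave_on (J \<times> J) (Phi f)" and pos: "0 < x1" "0 < y1" "0 < x" "0 < y"
  shows "Psi f (x1 + y1) (x + y) \<le> Psi f x1 x + Psi f y1 y"
proof -
  define a where "a = f x1 - f x"
  define b where "b = f y1 - f y"
  define k where "k = (\<lambda>t. f (g (f x + t * a) + g (f y + t * b)))"
  have k01: "k 0 = f (x + y)" "k 1 = f (x1 + y1)"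
    unfolding k_def a_def b_def using pos by simp_all
  have "DERIV k 0 :> p (x + y) * (a / p x + b / p y)"
    using DERIV_Phi_line[of "f x" 0 a "f y" b] pos unfolding k_def by simp
  then have "((\<lambda>t. (k (0 + t) - k 0) / t) \<longlongrightarrow> p (x + y) * (a / p x + b / p y)) (at_right 0)"
    unfolding DERIV_def by (rule tendsto_within_subset) auto
  moreover have "eventually (\<lambda>t. k 1 - k 0 \<le> (k (0 + t) - k 0) / t) (at_right 0)"
  proof -
    have "eventually (\<lambda>t::real. t < 1) (at_right 0)"
      using eventually_at_right_field zero_less_one by blast
    with eventually_at_right_less show ?thesis
    proof eventually_elim
      case (elim t)
      have "(1 - t) * Phi f (f x, f y) + t * Phi f (f x1, f y1)
          \<le> Phi f ((1 - t) *\<^sub>R (f x, f y) + t *\<^sub>R (f x1, f y1))"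
        using pos elim by (intro conc[unfolded concave_on_iff, THEN conjunct2, rule_format]) auto
      also have "(1 - t) *\<^sub>R (f x, f y) + t *\<^sub>R (f x1, f y1) = (f x + t * a, f y + t * b)"
        unfolding a_def b_def by (simp add: algebra_simps)
      finally have "(1 - t) * k 0 + t * k 1 \<le> k t"
        using pos unfolding k01 by (simp add: Phi_def k_def)
      then have "t * (k 1 - k 0) \<le> k t - k 0"
        by (simp add: algebra_simps)
      then show ?case
        using elim by (simp add: pos_le_divide_eq mult.commute)
    qed
  qed
  ultimately have "f (x1 + y1) - f (x + y) \<le> p (x + y) * (a / p x + b / p y)"
    unfolding k01 by (intro tendsto_lowerbound) auto
  then show ?thesis
    using pos unfolding Psi_def a_def b_def
    by (simp add: pos_divide_le_eq add_pos_pos mult.commute)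
qed

text \<open>The inequality for \<Psi> is the tangent inequality at the convex combination (u, v).
  Averaging it over the two given points with weights w and z cancels the linear terms.\<close>

lemma Psi_imp_concave_Phi:
  assumes Psi: "\<And>x1 y1 x y. 0 < x1 \<Longrightarrow> 0 < y1 \<Longrightarrow> 0 < x \<Longrightarrow> 0 < y
      \<Longrightarrow> Psi f (x1 + y1) (x + y) \<le> Psi f x1 x + Psi f y1 y"
  shows "concave_on (J \<times> J) (Phi f)"
  unfolding concave_on_iff
proof (intro conjI ballI allI impI convex_JJ)
  fix P Q and w z :: real
  assume PQ: "P \<in> J \<times> J" "Q \<in> J \<times> J" and wz: "0 \<le> w" "0 \<le> z" "w + z = 1"
  from PQ obtain x1 y1 x2 y2 where pos: "0 < x1" "0 < y1" "0 < x2" "0 < y2"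
    and PQ_eq: "P = (f x1, f y1)" "Q = (f x2, f y2)"
    by auto
  define u where "u = w * f x1 + z * f x2"
  define v where "v = w * f y1 + z * f y2"
  have M: "w *\<^sub>R P + z *\<^sub>R Q = (u, v)"
    unfolding PQ_eq u_def v_def by simp
  have "(u, v) \<in> J \<times> J"
    unfolding M[symmetric] using convex_JJ PQ wz unfolding convex_def by blast
  then have uv: "u \<in> J" "v \<in> J" by auto
  define x where "x = g u"
  define y where "y = g v"
  have xy: "0 < x" "0 < y" "f x = u" "f y = v"
    unfolding x_def y_def using uv by auto
  have tangent: "f (x' + y') \<le> f (x + y) + p (x + y) * ((f x' - u) / p x + (f y' - v) / p y)"
    if "0 < x'" "0 < y'" for x' y'
    using Psi[OF that xy(1,2)] xy unfolding Psi_def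
    by (simp add: pos_divide_le_eq add_pos_pos mult.commute)
  have "w * f (x1 + y1) + z * f (x2 + y2)
      \<le> w * (f (x + y) + p (x + y) * ((f x1 - u) / p x + (f y1 - v) / p y))
        + z * (f (x + y) + p (x + y) * ((f x2 - u) / p x + (f y2 - v) / p y))"
    using wz pos by (intro add_mono mult_left_mono tangent) auto
  also have "\<dots> = (w + z) * f (x + y)
      + p (x + y) * ((u - (w + z) * u) / p x + (v - (w + z) * v) / p y)"
    unfolding u_def v_def by (simp add: algebra_simps add_divide_distrib diff_divide_distrib)
  also have "\<dots> = f (x + y)"
    using wz by simp
  finally show "w * Phi f P + z * Phi f Q \<le> Phi f (w *\<^sub>R P + z *\<^sub>R Q)"
    unfolding M unfolding PQ_eq using pos by (simp add: Phi_def x_def y_def)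
qed

lemma subadditive_Psi_iff:
  "subadditive_pos 2 (\<lambda>z. Psi f (z 1) (z 2)) \<longleftrightarrow>
    (\<forall>x1 y1 x y. 0 < x1 \<longrightarrow> 0 < y1 \<longrightarrow> 0 < x \<longrightarrow> 0 < y
      \<longrightarrow> Psi f (x1 + y1) (x + y) \<le> Psi f x1 x + Psi f y1 y)"
proof safe
  fix x1 y1 x y :: real
  assume sub: "subadditive_pos 2 (\<lambda>z. Psi f (z 1) (z 2))" and "0 < x1" "0 < y1" "0 < x" "0 < y"
  then show "Psi f (x1 + y1) (x + y) \<le> Psi f x1 x + Psi f y1 y"
    using sub[unfolded subadditive_pos_def, rule_format,
        of "\<lambda>i. if i = 1 then x1 else x" "\<lambda>i. if i = 1 then y1 else y"] by simp
qed (auto simp: subadditive_pos_def)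

lemma concave_Phi_iff_Psi:
  "concave_on (J \<times> J) (Phi f) \<longleftrightarrow> subadditive_pos 2 (\<lambda>z. Psi f (z 1) (z 2))"
  unfolding subadditive_Psi_iff using concave_Phi_imp_Psi Psi_imp_concave_Phi by blast

end

section \<open>Regularity of the derivative\<close>

locale concave_generator = smooth_generator +
  assumes conc: "concave_on (J \<times> J) (Phi f)"
begin

lemma convex_f: "convex_on {0<..} f"
  using conc by (rule concave_Phi_imp_convex)

lemma right_deriv_f: "0 < x \<Longrightarrow> right_deriv f x = p x"
  by (rule right_deriv_eqI[OF has_field_derivative_at_within[OF DERIV_f]])

lemma left_deriv_f: "0 < x \<Longrightarrow> left_deriv f x = p x"
  by (rule left_deriv_eqI[OF has_field_derivative_at_within[OF DERIV_f]])

lemma p_mono: "0 < x \<Longrightarrow> x \<le> y \<Longrightarrow> p x \<le> p y"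
  using convex_on_right_deriv_mono[OF convex_f, of x y] by (simp add: right_deriv_f)

text \<open>For a differentiable convex function, the one-sided limits of the one-sided derivatives
  both equal the derivative.\<close>

lemma continuous_p: "continuous_on {0<..} p"
proof -
  have "isCont p x" if x: "0 < x" for x
  proof -
    have "(p \<longlongrightarrow> p x) (at_right x)"
    proof (rule Lim_transform_eventually)
      show "(right_deriv f \<longlongrightarrow> p x) (at_right x)"
        using convex_on_tendsto_right(1)[OF convex_f, of x] x by (simp add: right_deriv_f)
      show "eventually (\<lambda>y. right_deriv f y = p y) (at_right x)"
        using eventually_at_right_pos[OF x] by eventually_elim (rule right_deriv_f)
    qed
    moreover have "(p \<longlongrightarrow> p x) (at_left x)"
    proof (rule Lim_transform_eventually)
      show "(left_deriv f \<longlongrightarrow> p x) (at_left x)"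
        using convex_on_tendsto_left(1)[OF convex_f, of x] x by (simp add: left_deriv_f)
      show "eventually (\<lambda>y. left_deriv f y = p y) (at_left x)"
        using eventually_at_left_pos[OF x] by eventually_elim (rule left_deriv_f)
    qed
    ultimately show ?thesis
      unfolding isCont_def by (intro filterlim_split_at)
  qed
  then show ?thesis
    by (intro continuous_at_imp_continuous_on) auto
qed

text \<open>As \<open>Psi f d d\<close> vanishes, shifting both arguments of \<Psi> by d cannot
  increase it. Shifting (x + d, x) and (x, x + d) gives two bounds relating the increments A and B
  of f; in their product A and B cancel.\<close>

lemma p_log_midpoint:
  assumes "0 < x" "0 < d"
  shows "p x * p (x + 2 * d) \<le> (p (x + d))\<^sup>2"
proof -
  define A where "A = f (x + 2 * d) - f (x + d)"
  define B where "B = f (x + d) - f x"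
  have AB: "0 < A" "0 < B"
    using assms by (simp_all add: A_def B_def)
  have pp: "0 < p x" "0 < p (x + d)" "0 < p (x + 2 * d)"
    using assms by simp_all
  have "A / p (x + d) \<le> B / p x"
    using concave_Phi_imp_Psi[OF conc, of "x + d" d x d] assms
    unfolding Psi_def A_def B_def by (simp add: algebra_simps)
  then have "p x * A \<le> B * p (x + d)"
    using pp by (simp add: field_simps)
  moreover have "- A / p (x + 2 * d) \<le> - B / p (x + d)"
    using concave_Phi_imp_Psi[OF conc, of x d "x + d" d] assms
    unfolding Psi_def A_def B_def by (simp add: algebra_simps)
  then have "B * p (x + 2 * d) \<le> A * p (x + d)"
    using pp by (simp add: field_simps)
  ultimately have "(p x * A) * (B * p (x + 2 * d)) \<le> (B * p (x + d)) * (A * p (x + d))"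
    by (rule mult_mono) (use AB pp in auto)
  then have "(A * B) * (p x * p (x + 2 * d)) \<le> (A * B) * (p (x + d))\<^sup>2"
    by (simp add: power2_eq_square algebra_simps)
  then show ?thesis
    using AB by simp
qed

text \<open>The sign makes log-concavity of f' into convexity, so that the results on one-sided
  derivatives of convex functions apply.\<close>

definition h where "h = (\<lambda>x. - ln (p x))"

text \<open>\<open>L\<close> is the right logarithmic derivative of \<open>f'\<close>, that is \<open>f''\<^sub>+ / f'\<close>.\<close>

definition L where "L = (\<lambda>x. - right_deriv h x)"

lemma p_eq_exp: "0 < x \<Longrightarrow> p x = exp (- h x)"
  unfolding h_def by simp

lemma convex_h: "convex_on {0<..} h"
proof (rule continuous_midpoint_convex_imp_convex_on)
  have "p x \<noteq> 0" if "0 < x" for x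
    using p_pos[OF that] by linarith
  then show "continuous_on {0<..} h"
    unfolding h_def by (intro continuous_intros continuous_p) auto
next
  have *: "h ((1/2) *\<^sub>R (x + y)) \<le> (h x + h y) / 2" if "0 < x" "x < y" for x y :: real
  proof -
    define d where "d = (y - x) / 2"
    have d: "0 < d" "y = x + 2 * d" "(1/2) *\<^sub>R (x + y) = x + d"
      using that unfolding d_def by (auto simp: field_simps)
    have "ln (p x * p (x + 2 * d)) \<le> ln ((p (x + d))\<^sup>2)"
      using p_log_midpoint[OF that(1) d(1)] that d(1) p_pos[of "x + d"]
      by (subst ln_le_cancel_iff) (auto simp del: p_pos intro!: mult_pos_pos p_pos)
    then have "ln (p x) + ln (p (x + 2 * d)) \<le> 2 * ln (p (x + d))"
      using that d(1) by (simp add: ln_mult_pos ln_realpow)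
    then show ?thesis
      unfolding d(3) unfolding d(2) h_def by simp
  qed
  fix x y :: real assume "x \<in> {0<..}" "y \<in> {0<..}"
  then show "h ((1/2) *\<^sub>R (x + y)) \<le> (h x + h y) / 2"
    using *[of x y] *[of y x] by (cases x y rule: linorder_cases) (auto simp: add.commute)
qed simp

lemma right_deriv_p:
  assumes "0 < x"
  shows "(p has_real_derivative p x * L x) (at_right x)" "right_deriv p x = p x * L x"
proof -
  have "(h has_real_derivative right_deriv h x) (at_right x)"
    using convex_on_has_right_deriv[OF convex_h] assms by simp
  then have "((\<lambda>x. exp (- h x)) has_real_derivative p x * L x) (at_right x)"
    unfolding p_eq_exp[OF assms] L_def by (auto intro!: derivative_eq_intros)
  moreover have "eventually (\<lambda>y. p y = exp (- h y)) (at_right x)"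
    using eventually_at_right_pos[OF assms] by eventually_elim (rule p_eq_exp)
  ultimately show "(p has_real_derivative p x * L x) (at_right x)"
    using has_field_derivative_cong_eventually[where f = p and g = "\<lambda>x. exp (- h x)", OF _ p_eq_exp[OF assms]] by blast
  then show "right_deriv p x = p x * L x"
    by (rule right_deriv_eqI)
qed

lemma left_deriv_p:
  assumes "0 < x"
  shows "(p has_real_derivative - p x * left_deriv h x) (at_left x)"
    "left_deriv p x = - p x * left_deriv h x"
proof -
  have "(h has_real_derivative left_deriv h x) (at_left x)"
    using convex_on_has_left_deriv[OF convex_h] assms by simp
  then have "((\<lambda>x. exp (- h x)) has_real_derivative - p x * left_deriv h x) (at_left x)"
    unfolding p_eq_exp[OF assms] by (auto intro!: derivative_eq_intros)
  moreover have "eventually (\<lambda>y. p y = exp (- h y)) (at_left x)"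
    using eventually_at_left_pos[OF assms] by eventually_elim (rule p_eq_exp)
  ultimately show "(p has_real_derivative - p x * left_deriv h x) (at_left x)"
    using has_field_derivative_cong_eventually[where f = p and g = "\<lambda>x. exp (- h x)", OF _ p_eq_exp[OF assms]] by blast
  then show "left_deriv p x = - p x * left_deriv h x"
    by (rule left_deriv_eqI)
qed

text \<open>The one-sided derivatives of f' = exp (-h) are -f' times those of \<open>h\<close>.
  Since f' is continuous, the required limits are inherited from the convex
  \<open>h\<close>.\<close>

lemma cont_semi_differentiable_p: "cont_semi_differentiable_on p {0<..}"
  unfolding cont_semi_differentiable_on_def
proof (intro conjI ballI)
  fix x :: real assume "x \<in> {0<..}"
  then have x: "0 < x" by simp
  show "semi_differentiable_at p x"
    unfolding semi_differentiable_at_def using right_deriv_p(1)[OF x] left_deriv_p(1)[OF x] by blast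
  have "isCont p x"
    using continuous_on_eq_continuous_at[THEN iffD1, OF open_greaterThan continuous_p] x by simp
  then have p_lim: "(p \<longlongrightarrow> p x) (at_left x)" "(p \<longlongrightarrow> p x) (at_right x)"
    by (auto simp: isCont_def intro: tendsto_within_subset)
  note evl = eventually_at_left_pos[OF x] and evr = eventually_at_right_pos[OF x]
  note R = convex_on_tendsto_right[OF convex_h, of x] and L = convex_on_tendsto_left[OF convex_h, of x]
  have "((\<lambda>y. - p y * left_deriv h y) \<longlongrightarrow> - p x * left_deriv h x) (at_left x)"
    using x by (intro tendsto_intros p_lim L) auto
  then show "(left_deriv p \<longlongrightarrow> left_deriv p x) (at_left x)"
    unfolding left_deriv_p(2)[OF x]
    by (rule Lim_transform_eventually) (use evl in eventually_elim, simp add: left_deriv_p)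
  have "((\<lambda>y. - p y * right_deriv h y) \<longlongrightarrow> - p x * left_deriv h x) (at_left x)"
    using x by (intro tendsto_intros p_lim L) auto
  then show "(right_deriv p \<longlongrightarrow> left_deriv p x) (at_left x)"
    unfolding left_deriv_p(2)[OF x]
    by (rule Lim_transform_eventually) (use evl in eventually_elim, simp add: right_deriv_p L_def)
  have "((\<lambda>y. - p y * left_deriv h y) \<longlongrightarrow> - p x * right_deriv h x) (at_right x)"
    using x by (intro tendsto_intros p_lim R) auto
  then show "(left_deriv p \<longlongrightarrow> right_deriv p x) (at_right x)"
    unfolding right_deriv_p(2)[OF x] L_def mult_minus_left mult_minus_right
    by (rule Lim_transform_eventually) (use evr in eventually_elim, simp add: left_deriv_p)
  have "((\<lambda>y. - p y * right_deriv h y) \<longlongrightarrow> - p x * right_deriv h x) (at_right x)"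
    using x by (intro tendsto_intros p_lim R) auto
  then show "(right_deriv p \<longlongrightarrow> right_deriv p x) (at_right x)"
    unfolding right_deriv_p(2)[OF x] L_def mult_minus_left mult_minus_right
    by (rule Lim_transform_eventually) (use evr in eventually_elim, simp add: right_deriv_p L_def)
qed

section \<open>Superadditivity of the reciprocal of f''_+ / f'\<close>

lemma L_antimono: "0 < x \<Longrightarrow> x \<le> y \<Longrightarrow> L y \<le> L x"
  using convex_on_right_deriv_mono[OF convex_h, of x y] by (simp add: L_def)

lemma L_tendsto: "0 < x \<Longrightarrow> (L \<longlongrightarrow> L x) (at_right x)"
  unfolding L_def using convex_on_tendsto_right(1)[OF convex_h, of x] by (intro tendsto_minus) simp

lemma L_nonneg: "0 < x \<Longrightarrow> 0 \<le> L x"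
proof -
  assume x: "0 < x"
  have "right_deriv h x \<le> (h (x + 1) - h x) / (x + 1 - x)"
    using x by (intro right_deriv_le_slope[OF convex_h]) auto
  also have "\<dots> \<le> 0"
    using p_mono[OF x, of "x + 1"] x unfolding h_def by simp
  finally show "0 \<le> L x"
    unfolding L_def by simp
qed

text \<open>One application of l'Hospital's rule leaves a multiple of the right difference quotient
  of f' at x; thus a second derivative of f is used only at x and only from the right.\<close>

lemma Psi_second_order:
  assumes "0 < x" "0 < c"
  shows "((\<lambda>t. (Psi f (x + c * t) x - c * t) / t\<^sup>2) \<longlongrightarrow> c\<^sup>2 * L x / 2) (at_right 0)"
proof (rule lhopital_right[where f' = "\<lambda>t. c * p (x + c * t) / p x - c" and g' = "\<lambda>t. 2 * t"])
  have px: "0 < p x"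
    using assms by simp
  have "isCont f x"
    using DERIV_f[OF assms(1)] DERIV_isCont by blast
  then have "((\<lambda>t. f (x + c * t)) \<longlongrightarrow> f (x + c * 0)) (at_right 0)"
    by (intro isCont_tendsto_compose[of _ f] tendsto_intros) auto
  then have "((\<lambda>t. Psi f (x + c * t) x - c * t) \<longlongrightarrow> (f (x + c * 0) - f x) / p x - c * 0) (at_right 0)"
    unfolding Psi_def using px by (intro tendsto_intros) auto
  then show "((\<lambda>t. Psi f (x + c * t) x - c * t) \<longlongrightarrow> 0) (at_right 0)"
    by simp
  show "((\<lambda>t::real. t\<^sup>2) \<longlongrightarrow> 0) (at_right 0)"
    by (auto intro!: tendsto_eq_intros)
  show "eventually (\<lambda>t::real. t\<^sup>2 \<noteq> 0) (at_right 0)" "eventually (\<lambda>t::real. 2 * t \<noteq> 0) (at_right 0)"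
    using eventually_at_right_less[of "0::real"] by (eventually_elim, simp)+
  show "eventually (\<lambda>t. DERIV (\<lambda>t. Psi f (x + c * t) x - c * t) t :> c * p (x + c * t) / p x - c) (at_right 0)"
    using eventually_at_right_less
  proof eventually_elim
    case (elim t)
    have "DERIV (\<lambda>t. f (x + c * t)) t :> p (x + c * t) * c"
      using assms elim by (intro DERIV_chain2[OF DERIV_f]) (auto intro!: add_pos_pos derivative_eq_intros)
    then show ?case
      unfolding Psi_def using px by (auto intro!: derivative_eq_intros)
  qed
  show "eventually (\<lambda>t::real. DERIV (\<lambda>t. t\<^sup>2) t :> 2 * t) (at_right 0)"
    by (auto intro!: derivative_eq_intros always_eventually)
  have "((\<lambda>t. c / (2 * p x) * ((p (x + c * t) - p x) / t)) \<longlongrightarrow> c / (2 * p x) * (c * (p x * L x))) (at_right 0)"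
    by (intro tendsto_intros has_real_derivative_right_quotient right_deriv_p assms)
  moreover have "c / (2 * p x) * (c * (p x * L x)) = c\<^sup>2 * L x / 2"
    using px by (simp add: power2_eq_square)
  moreover have "c / (2 * p x) * ((p (x + c * t) - p x) / t) = (c * p (x + c * t) / p x - c) / (2 * t)" for t
    using px by (cases "t = 0") (simp_all add: field_simps)
  ultimately show "((\<lambda>t. (c * p (x + c * t) / p x - c) / (2 * t)) \<longlongrightarrow> c\<^sup>2 * L x / 2) (at_right 0)"
    by (simp only:)
qed

text \<open>On the diagonal \<Psi> vanishes and has slope 1 in its first argument. So for increments
  a t, b t and (a + b) t the linear terms cancel, and subadditivity is decided by the coefficients
  of t^2.\<close>

lemma L_quadratic:
  assumes "0 < x" "0 < y" "0 < a" "0 < b"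
  shows "(a + b)\<^sup>2 * L (x + y) \<le> a\<^sup>2 * L x + b\<^sup>2 * L y"
proof -
  have "(a + b)\<^sup>2 * L (x + y) / 2 \<le> a\<^sup>2 * L x / 2 + b\<^sup>2 * L y / 2"
  proof (rule tendsto_le[OF trivial_limit_at_right_real])
    show "((\<lambda>t. (Psi f (x + y + (a + b) * t) (x + y) - (a + b) * t) / t\<^sup>2)
        \<longlongrightarrow> (a + b)\<^sup>2 * L (x + y) / 2) (at_right 0)"
      using assms by (intro Psi_second_order) auto
    show "((\<lambda>t. (Psi f (x + a * t) x - a * t) / t\<^sup>2 + (Psi f (y + b * t) y - b * t) / t\<^sup>2)
        \<longlongrightarrow> a\<^sup>2 * L x / 2 + b\<^sup>2 * L y / 2) (at_right 0)"
      using assms by (intro tendsto_add Psi_second_order) auto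
    show "eventually (\<lambda>t. (Psi f (x + y + (a + b) * t) (x + y) - (a + b) * t) / t\<^sup>2
        \<le> (Psi f (x + a * t) x - a * t) / t\<^sup>2 + (Psi f (y + b * t) y - b * t) / t\<^sup>2) (at_right 0)"
      using eventually_at_right_less
    proof eventually_elim
      case (elim t)
      have "Psi f (x + a * t + (y + b * t)) (x + y) \<le> Psi f (x + a * t) x + Psi f (y + b * t) y"
        using assms elim by (intro concave_Phi_imp_Psi[OF conc]) (auto intro!: add_pos_pos)
      then have "Psi f (x + y + (a + b) * t) (x + y) - (a + b) * t
          \<le> (Psi f (x + a * t) x - a * t) + (Psi f (y + b * t) y - b * t)"
        by (simp add: algebra_simps)
      then show ?case
        unfolding add_divide_distrib[symmetric] by (rule divide_right_mono) simp
    qed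
  qed
  then show ?thesis by simp
qed

text \<open>With a = 1 / L x and b = 1 / L y the right side of \<open>L_quadratic\<close> collapses
  to s = a + b, leaving s^2 L (x + y) \<le> s. Positivity of L x and L y comes from L
  decreasing.\<close>

lemma L_superadditive:
  assumes "0 < x" "0 < y" "0 < L (x + y)"
  shows "1 / L x + 1 / L y \<le> 1 / L (x + y)"
proof -
  have L: "0 < L x" "0 < L y"
    using L_antimono[of x "x + y"] L_antimono[of y "x + y"] assms by linarith+
  define s where "s = 1 / L x + 1 / L y"
  have s: "0 < s"
    unfolding s_def using L by (intro add_pos_pos) auto
  have "s\<^sup>2 * L (x + y) \<le> (1 / L x)\<^sup>2 * L x + (1 / L y)\<^sup>2 * L y"
    unfolding s_def using assms L by (intro L_quadratic) auto
  also have "\<dots> = s"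
    unfolding s_def using L by (simp add: power2_eq_square)
  finally have "s * (s * L (x + y)) \<le> s * 1"
    by (simp add: power2_eq_square mult.assoc)
  then have "s * L (x + y) \<le> 1"
    using s by simp
  then show ?thesis
    using assms unfolding s_def[symmetric] by (simp add: pos_le_divide_eq)
qed

text \<open>The right derivative of f' is f' times L, so the quotient in (v) is 1 / L and all
  clauses concern the decreasing function L alone.\<close>

lemma threshold:
  "\<exists>\<alpha>::ereal. 0 \<le> \<alpha> \<and>
     (\<forall>x>0. ereal x < \<alpha> \<longrightarrow> 0 < right_deriv p x) \<and>
     (\<forall>x>0. \<alpha> \<le> ereal x \<longrightarrow> right_deriv p x = 0) \<and>
     mono_on {x. 0 < x \<and> ereal x < \<alpha>} (\<lambda>x. p x / right_deriv p x) \<and>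
     (\<forall>x>0. \<forall>y>0. ereal (x + y) < \<alpha> \<longrightarrow>
        p x / right_deriv p x + p y / right_deriv p y \<le> p (x + y) / right_deriv p (x + y))"
proof -
  \<comment> \<open>The inserted 0 gives \<alpha> = 0 when L vanishes everywhere, where the supremum
    of the empty set would be minus infinity.\<close>
  define \<alpha> where "\<alpha> = Sup (insert 0 (ereal ` {x. 0 < x \<and> 0 < L x}))"
  have below: "0 < L x" if "0 < x" "ereal x < \<alpha>" for x
  proof -
    have "\<not> ereal x < 0"
      using that(1) by simp
    with that obtain z where "0 < L z" "x < z"
      unfolding \<alpha>_def less_Sup_iff by auto
    then show ?thesis
      using L_antimono[of x z] that(1) by linarith
  qed
  have above: "L x = 0" if "0 < x" "\<alpha> \<le> ereal x" for x
  proof (rule ccontr)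
    assume "L x \<noteq> 0"
    then have "0 < L x"
      using L_nonneg[OF that(1)] by simp
    \<comment> \<open>Right continuity of L: positivity at x would persist at some z > x,
      contradicting \<alpha> \<le> x. Hence L already vanishes at a positive finite
      \<alpha>.\<close>
    then have "eventually (\<lambda>z. 0 < L z \<and> x < z) (at_right x)"
      using order_tendstoD(1)[OF L_tendsto[OF that(1)]] eventually_at_right_less
      by (intro eventually_conj) auto
    then obtain z where z: "0 < L z" "x < z"
      using eventually_happens'[OF trivial_limit_at_right_real] by blast
    then have "ereal z \<le> \<alpha>"
      unfolding \<alpha>_def using that(1) by (intro Sup_upper) auto
    then have "ereal z \<le> ereal x"
      using that(2) by (rule order_trans)
    with z(2) show False
      by simp
  qed
  have quot: "p x / right_deriv p x = 1 / L x" if "0 < x" for x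
  proof -
    have "0 < p x" using that by simp
    then show ?thesis
      using right_deriv_p(2)[OF that] by simp
  qed
  have "0 \<le> \<alpha>"
    unfolding \<alpha>_def by (intro Sup_upper) simp
  moreover have "0 < right_deriv p x" if "0 < x" "ereal x < \<alpha>" for x
    using right_deriv_p(2)[OF that(1)] below[OF that] that(1) by simp
  moreover have "right_deriv p x = 0" if "0 < x" "\<alpha> \<le> ereal x" for x
    using right_deriv_p(2)[OF that(1)] above[OF that] by simp
  moreover have "mono_on {x. 0 < x \<and> ereal x < \<alpha>} (\<lambda>x. p x / right_deriv p x)"
  proof (rule mono_onI)
    fix x y assume "x \<in> {x. 0 < x \<and> ereal x < \<alpha>}" "y \<in> {x. 0 < x \<and> ereal x < \<alpha>}" "x \<le> y"
    then show "p x / right_deriv p x \<le> p y / right_deriv p y"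
      using L_antimono[of x y] below[of y] by (auto simp: quot intro!: divide_left_mono)
  qed
  moreover have "p x / right_deriv p x + p y / right_deriv p y \<le> p (x + y) / right_deriv p (x + y)"
    if "0 < x" "0 < y" "ereal (x + y) < \<alpha>" for x y
    using L_superadditive[of x y] below[of "x + y"] that by (simp add: quot add_pos_pos)
  ultimately show ?thesis
    by blast
qed

end

section \<open>Concavity from superadditivity\<close>

text \<open>\<open>quadratic\<close> is the form in which (v) enters concavity. It does not divide
  by f''_+ and therefore makes sense beyond \<alpha> as well; A and B stand for velocities and may
  have any sign.\<close>

locale semismooth_generator = smooth_generator +
  assumes csd: "cont_semi_differentiable_on p {0<..}"
    and quadratic: "\<And>x y A B. 0 < x \<Longrightarrow> 0 < y \<Longrightarrow>
      right_deriv p (x + y) / p (x + y) * (A + B)\<^sup>2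
        \<le> right_deriv p x / p x * A\<^sup>2 + right_deriv p y / p y * B\<^sup>2"
begin

lemma has_right_deriv_p: "0 < x \<Longrightarrow> (p has_real_derivative right_deriv p x) (at_right x)"
  using csd right_deriv_eqI unfolding cont_semi_differentiable_on_def semi_differentiable_at_def
  by fastforce

lemma has_left_deriv_p: "0 < x \<Longrightarrow> (p has_real_derivative left_deriv p x) (at_left x)"
  using csd left_deriv_eqI unfolding cont_semi_differentiable_on_def semi_differentiable_at_def
  by fastforce

lemma isCont_p: "0 < x \<Longrightarrow> isCont p x"
  using DERIV_continuous[OF has_right_deriv_p] DERIV_continuous[OF has_left_deriv_p]
  by (simp add: continuous_at_split)

text \<open>The derivative of f' toward the side to which a point with velocity C moves. Counting C
  = 0 as the right side fits a point that stays constant, along which right derivatives are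
  taken.\<close>

definition side_deriv :: "real \<Rightarrow> real \<Rightarrow> real" where
  "side_deriv C x = (if 0 \<le> C then right_deriv p x else left_deriv p x)"

lemma p_path_right_deriv:
  assumes "DERIV z t :> C" "0 < z t"
  shows "((\<lambda>t. p (z t)) has_real_derivative side_deriv C (z t) * C) (at_right t)"
  unfolding side_deriv_def
  using has_real_derivative_right_chain[OF has_right_deriv_p has_left_deriv_p] assms by blast

text \<open>Continuous semi-differentiability lets right derivatives alone produce both one-sided
  values, as they tend to the left derivative from the left. A nonconstant path of velocity 0 is
  excluded because it may visit both sides.\<close>

lemma side_deriv_tendsto:
  assumes z: "DERIV z t :> C" "0 < z t" and C: "C \<noteq> 0 \<or> (\<exists>c. z = (\<lambda>_. c))"
  shows "((\<lambda>s. right_deriv p (z s) / p (z s)) \<longlongrightarrow> side_deriv C (z t) / p (z t)) (at_right t)"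
proof -
  have "isCont (\<lambda>s. p (z s)) t"
    using isCont_o2[OF DERIV_isCont[OF z(1)] isCont_p[OF z(2)]] .
  then have plim: "((\<lambda>s. p (z s)) \<longlongrightarrow> p (z t)) (at_right t)"
    unfolding isCont_def by (rule tendsto_within_subset) simp
  consider "0 < C" | "C < 0" | c where "z = (\<lambda>_. c)" "C = 0"
    using C linorder_less_linear[of C 0] by blast
  then have "((\<lambda>s. right_deriv p (z s)) \<longlongrightarrow> side_deriv C (z t)) (at_right t)"
  proof cases
    case 1
    have "(right_deriv p \<longlongrightarrow> right_deriv p (z t)) (at_right (z t))"
      using csd z(2) unfolding cont_semi_differentiable_on_def by simp
    from filterlim_compose[OF this DERIV_pos_filterlim_at_right[OF z(1) 1]]
    show ?thesis
      using 1 by (simp add: side_deriv_def)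
  next
    case 2
    have "(right_deriv p \<longlongrightarrow> left_deriv p (z t)) (at_left (z t))"
      using csd z(2) unfolding cont_semi_differentiable_on_def by simp
    from filterlim_compose[OF this DERIV_neg_filterlim_at_left[OF z(1) 2]]
    show ?thesis
      using 2 by (simp add: side_deriv_def)
  next
    case 3
    then show ?thesis
      by (simp add: side_deriv_def)
  qed
  moreover have "p (z t) \<noteq> 0"
    using p_pos[OF z(2)] by linarith
  ultimately show ?thesis
    using plim by (intro tendsto_divide)
qed

text \<open>With \<open>\<phi>\<close> the restriction of \<open>\<Phi>\<close> to a line, the right derivative of \<open>\<phi>'\<close> is a quadratic form
  in the velocities \<open>A\<close>, \<open>B\<close> of the two arguments, whose coefficients are one-sided limits
  of \<open>f''\<^sub>+ / f'\<close>, the sides depending on the signs of \<open>A\<close>, \<open>B\<close> and \<open>A + B\<close>.\<close>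

lemma line_deriv_right_deriv_nonpos:
  fixes u a v b :: real
  defines "x \<equiv> \<lambda>t. g (u + t * a)" and "y \<equiv> \<lambda>t. g (v + t * b)"
  assumes J: "u + t * a \<in> J" "v + t * b \<in> J"
  shows "\<exists>d\<le>0. ((\<lambda>t. p (x t + y t) * (a / p (x t) + b / p (y t))) has_real_derivative d) (at_right t)"
proof -
  define A where "A = a / p (x t)"
  define B where "B = b / p (y t)"
  define m where "m = (\<lambda>C z. side_deriv C z / p z)"
  have pos: "0 < x t" "0 < y t" "0 < x t + y t"
    unfolding x_def y_def using J by (auto intro: add_pos_pos)
  then have pp: "0 < p (x t)" "0 < p (y t)" "0 < p (x t + y t)"
    by simp_all
  have Dx: "DERIV x t :> A" and Dy: "DERIV y t :> B"
    unfolding x_def y_def A_def B_def using J by (auto intro: DERIV_g_line)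
  then have Ds: "DERIV (\<lambda>t. x t + y t) t :> A + B"
    by (rule DERIV_add)
  have "p (x t) \<noteq> 0" "p (y t) \<noteq> 0"
    using pp by linarith+
  \<comment> \<open>Zero velocity forces a = 0 or b = 0, as f' is finite and positive, and then that
    argument does not depend on the parameter at all.\<close>
  then have const: "A \<noteq> 0 \<or> (\<exists>c. x = (\<lambda>_. c))" "B \<noteq> 0 \<or> (\<exists>c. y = (\<lambda>_. c))"
    by (auto simp: A_def B_def x_def y_def)
  have ab: "a = A * p (x t)" "b = B * p (y t)"
    unfolding A_def B_def using pp by simp_all
  have side: "side_deriv C z = m C z * p z" if "0 < p z" for C z
    using that unfolding m_def by simp
  \<comment> \<open>\<open>quadratic\<close> is used at the positions for s > t with A and B frozen,
    and then s tends to t; the motion itself selects a compatible triple of sides.\<close>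
  have "m (A + B) (x t + y t) * (A + B)\<^sup>2 \<le> m A (x t) * A\<^sup>2 + m B (y t) * B\<^sup>2"
  proof -
    have limx: "((\<lambda>s. right_deriv p (x s) / p (x s) * A\<^sup>2) \<longlongrightarrow> m A (x t) * A\<^sup>2) (at_right t)"
      unfolding m_def
      by (intro tendsto_mult side_deriv_tendsto[OF Dx pos(1) const(1)] tendsto_const)
    have limy: "((\<lambda>s. right_deriv p (y s) / p (y s) * B\<^sup>2) \<longlongrightarrow> m B (y t) * B\<^sup>2) (at_right t)"
      unfolding m_def
      by (intro tendsto_mult side_deriv_tendsto[OF Dy pos(2) const(2)] tendsto_const)
    have lims: "((\<lambda>s. right_deriv p (x s + y s) / p (x s + y s) * (A + B)\<^sup>2)
        \<longlongrightarrow> m (A + B) (x t + y t) * (A + B)\<^sup>2) (at_right t)"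
    \<comment> \<open>If A + B = 0, the sum may oscillate about its value and the quotient may have
      no limit, but the factor (A + B)^2 makes both sides 0.\<close>
    proof (cases "A + B = 0")
      case False
      then show ?thesis
        unfolding m_def
        by (intro tendsto_mult side_deriv_tendsto[OF Ds pos(3)] tendsto_const disjI1)
    qed simp
    have ev: "eventually (\<lambda>s. 0 < z s) (at_right t)" if "DERIV z t :> C" "0 < z t" for z :: "real \<Rightarrow> real" and C
    proof -
      have "(z \<longlongrightarrow> z t) (at_right t)"
        using DERIV_isCont[OF that(1)] unfolding isCont_def by (rule tendsto_within_subset) simp
      then show ?thesis
        using that(2) by (rule order_tendstoD(1))
    qed
    show ?thesis
    proof (rule tendsto_le[OF trivial_limit_at_right_real tendsto_add[OF limx limy] lims])
      show "eventually (\<lambda>s. right_deriv p (x s + y s) / p (x s + y s) * (A + B)\<^sup>2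
          \<le> right_deriv p (x s) / p (x s) * A\<^sup>2 + right_deriv p (y s) / p (y s) * B\<^sup>2) (at_right t)"
        using ev[OF Dx pos(1)] ev[OF Dy pos(2)] by eventually_elim (rule quadratic)
    qed
  qed
  then have "p (x t + y t) * (m (A + B) (x t + y t) * (A + B)\<^sup>2 - m A (x t) * A\<^sup>2 - m B (y t) * B\<^sup>2) \<le> 0"
    using pp(3) by (intro mult_nonneg_nonpos) auto
  moreover have "((\<lambda>t. p (x t + y t) * (a / p (x t) + b / p (y t))) has_real_derivative
      p (x t + y t) * (m (A + B) (x t + y t) * (A + B)\<^sup>2 - m A (x t) * A\<^sup>2 - m B (y t) * B\<^sup>2)) (at_right t)"
  proof -
    have quot: "((\<lambda>t. c / p (z t)) has_real_derivative - m C (z t) * C\<^sup>2) (at_right t)"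
      if z: "DERIV z t :> C" "0 < z t" and c: "c = C * p (z t)" for z c C
    proof -
      have "p (z t) \<noteq> 0"
        using p_pos[OF z(2)] by linarith
      then show ?thesis
        unfolding c m_def power2_eq_square
        by (auto intro!: derivative_eq_intros p_path_right_deriv[OF z])
    qed
    have "((\<lambda>t. p (x t + y t) * (a / p (x t) + b / p (y t))) has_real_derivative
        side_deriv (A + B) (x t + y t) * (A + B) * (a / p (x t) + b / p (y t))
        + (- m A (x t) * A\<^sup>2 + - m B (y t) * B\<^sup>2) * p (x t + y t)) (at_right t)"
      by (intro DERIV_mult DERIV_add p_path_right_deriv[OF Ds pos(3)] quot Dx Dy pos ab)
    moreover have "side_deriv (A + B) (x t + y t) * (A + B) * (a / p (x t) + b / p (y t))
        + (- m A (x t) * A\<^sup>2 + - m B (y t) * B\<^sup>2) * p (x t + y t)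
        = p (x t + y t) * (m (A + B) (x t + y t) * (A + B)\<^sup>2 - m A (x t) * A\<^sup>2 - m B (y t) * B\<^sup>2)"
      unfolding side[OF pp(3)] A_def[symmetric] B_def[symmetric]
      by (simp add: algebra_simps power2_eq_square)
    ultimately show ?thesis by simp
  qed
  ultimately show ?thesis by blast
qed

text \<open>On a segment, the derivative of \<Phi> is continuous with nonpositive right derivative,
  hence decreasing, so \<Phi> is concave along it.\<close>

lemma concave_Phi: "concave_on (J \<times> J) (Phi f)"
  unfolding concave_on_def
proof (rule convex_onI)
  fix T and P Q assume T: "0 < (T::real)" "T < 1" and PQ: "P \<in> J \<times> J" "Q \<in> J \<times> J"
  obtain u v where P: "P = (u, v)" by force
  obtain u' v' where Q: "Q = (u', v')" by force
  define a where "a = u' - u"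
  define b where "b = v' - v"
  define k where "k = (\<lambda>t. f (g (u + t * a) + g (v + t * b)))"
  define k' where "k' = (\<lambda>t. p (g (u + t * a) + g (v + t * b))
    * (a / p (g (u + t * a)) + b / p (g (v + t * b))))"
  have J: "u + t * a \<in> J" "v + t * b \<in> J" if "t \<in> {0..1}" for t
    using PQ that unfolding P Q a_def b_def by (auto intro!: J_segment)
  have "continuous_on {0..1} k'"
  proof (rule continuous_at_imp_continuous_on, rule ballI)
    fix t :: real assume t: "t \<in> {0..1}"
    have x: "isCont (\<lambda>t. g (u + t * a)) t" "0 < g (u + t * a)"
      and y: "isCont (\<lambda>t. g (v + t * b)) t" "0 < g (v + t * b)"
      using J[OF t] DERIV_g_line DERIV_isCont by (blast intro: g_pos)+
    have "p (g (u + t * a)) \<noteq> 0" "p (g (v + t * b)) \<noteq> 0"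
      using p_pos[OF x(2)] p_pos[OF y(2)] by linarith+
    moreover have "isCont (\<lambda>t. p (g (u + t * a))) t" "isCont (\<lambda>t. p (g (v + t * b))) t"
      by (rule isCont_o2[OF x(1) isCont_p[OF x(2)]], rule isCont_o2[OF y(1) isCont_p[OF y(2)]])
    moreover have "isCont (\<lambda>t. p (g (u + t * a) + g (v + t * b))) t"
      by (rule isCont_o2[OF isCont_add[OF x(1) y(1)] isCont_p[OF add_pos_pos[OF x(2) y(2)]]])
    ultimately show "isCont k' t"
      unfolding k'_def by (intro isCont_mult isCont_add isCont_divide continuous_const)
  qed
  then have mono: "k' t \<le> k' s" if "s \<in> {0..1}" "t \<in> {0..1}" "s \<le> t" for s t
  proof (rule right_deriv_nonpos_imp_nonincreasing[OF that(3) continuous_on_subset])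
    show "\<exists>d\<le>0. (k' has_real_derivative d) (at_right r)" if "s \<le> r" "r < t" for r
      unfolding k'_def using that \<open>s \<in> {0..1}\<close> \<open>t \<in> {0..1}\<close>
      by (intro line_deriv_right_deriv_nonpos J) auto
  qed (use that in auto)
  have "convex_on {0..1} (\<lambda>t. - k t)"
  proof (rule convex_on_realI)
    show "DERIV (\<lambda>t. - k t) t :> - k' t" if "t \<in> {0..1}" for t
      unfolding k_def k'_def using J[OF that] by (intro DERIV_minus DERIV_Phi_line)
  qed (auto simp: mono)
  from convex_onD[OF this, of T 0 1] T have "- k T \<le> (1 - T) * - k 0 + T * - k 1"
    by simp
  moreover have "(1 - T) *\<^sub>R P + T *\<^sub>R Q = (u + T * a, v + T * b)"
    unfolding P Q a_def b_def by (simp add: algebra_simps)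
  ultimately show "- Phi f ((1 - T) *\<^sub>R P + T *\<^sub>R Q) \<le> (1 - T) * - Phi f P + T * - Phi f Q"
    unfolding k_def P Q a_def b_def Phi_def by simp
qed (rule convex_JJ)

end

text \<open>Weighted Cauchy-Schwarz: the gap between (1 / l + 1 / m) (l A^2 + m B^2) and (A + B)^2
  is the explicit square (l A - m B)^2 / (l m).\<close>

lemma harmonic_quadratic:
  fixes l m n A B :: real
  assumes "0 < l" "0 < m" "0 < n" "1 / l + 1 / m \<le> 1 / n"
  shows "n * (A + B)\<^sup>2 \<le> l * A\<^sup>2 + m * B\<^sup>2"
proof -
  have "0 \<le> (l * A - m * B)\<^sup>2 / (l * m)"
    using assms by simp
  also have "\<dots> = (1 / l + 1 / m) * (l * A\<^sup>2 + m * B\<^sup>2) - (A + B)\<^sup>2"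
    using assms by (simp add: field_simps power2_eq_square)
  finally have "(A + B)\<^sup>2 \<le> (1 / l + 1 / m) * (l * A\<^sup>2 + m * B\<^sup>2)"
    by simp
  also have "\<dots> \<le> 1 / n * (l * A\<^sup>2 + m * B\<^sup>2)"
    using assms by (intro mult_right_mono) auto
  finally show ?thesis
    using assms by (simp add: field_simps)
qed

theorem theorem4p1:
  fixes f :: "real \<Rightarrow> real"
  assumes "continuous_on {0<..} f"
    and "strict_mono_on {0<..} f"
  shows
    "((\<forall>n\<ge>1. subadditive_pos n (quasi_arith_mean f n)) \<longleftrightarrow>
        subadditive_pos 2 (quasi_arith_mean f 2)) \<and>
     (subadditive_pos 2 (quasi_arith_mean f 2) \<longleftrightarrow>
        concave_on (f ` {0<..} \<times> f ` {0<..}) (Phi f)) \<and>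
     (concave_on (f ` {0<..} \<times> f ` {0<..}) (Phi f) \<longleftrightarrow>
        differentiable_pos_deriv f \<and> subadditive_pos 2 (\<lambda>z. Psi f (z 1) (z 2))) \<and>
     (differentiable_pos_deriv f \<and> subadditive_pos 2 (\<lambda>z. Psi f (z 1) (z 2)) \<longleftrightarrow>
        differentiable_pos_deriv f \<and>
        cont_semi_differentiable_on (deriv f) {0<..} \<and>
        (\<exists>\<alpha>::ereal. 0 \<le> \<alpha> \<and>
           (\<forall>x>0. ereal x < \<alpha> \<longrightarrow> 0 < right_deriv (deriv f) x) \<and>
           (\<forall>x>0. \<alpha> \<le> ereal x \<longrightarrow> right_deriv (deriv f) x = 0) \<and>
           mono_on {x. 0 < x \<and> ereal x < \<alpha>} (\<lambda>x. deriv f x / right_deriv (deriv f) x) \<and>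
           (\<forall>x>0. \<forall>y>0. ereal (x + y) < \<alpha> \<longrightarrow>
              deriv f x / right_deriv (deriv f) x + deriv f y / right_deriv (deriv f) y
                \<le> deriv f (x + y) / right_deriv (deriv f) (x + y))))"
    (is "(?i \<longleftrightarrow> ?ii) \<and> (?ii \<longleftrightarrow> ?iii) \<and> (?iii \<longleftrightarrow> ?diff \<and> ?iv) \<and> (_ \<longleftrightarrow> ?diff \<and> ?csd \<and> ?\<alpha>)")
proof -
  interpret mean_generator f
    using assms by unfold_locales
  have smooth: "smooth_generator f" if ?diff
    using that by unfold_locales
  \<comment> \<open>Concavity of \<Phi> is the hub: (i), (ii), (iii) form a cycle, and (iv) and (v)
    are each tied to (iii).\<close>
  have "?i \<Longrightarrow> ?ii"
    by simp
  moreover have "?ii \<Longrightarrow> ?iii"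
    by (rule subadditive_imp_concave_Phi)
  moreover have "?iii \<Longrightarrow> ?i"
    using concave_Phi_imp_subadditive by blast
  moreover have "?iii \<longleftrightarrow> ?diff \<and> ?iv"
    using concave_Phi_imp_differentiable smooth_generator.concave_Phi_iff_Psi[OF smooth] by blast
  moreover have "?csd \<and> ?\<alpha>" if ?iii
  proof -
    interpret smooth_generator f
      by (rule smooth[OF concave_Phi_imp_differentiable[OF that]])
    interpret concave_generator f
      using that by unfold_locales
    show ?thesis
      using cont_semi_differentiable_p threshold by blast
  qed
  moreover have ?iii if diff': ?diff and csd': ?csd and ex: ?\<alpha>
  proof -
    interpret smooth_generator f
      by (rule smooth[OF diff'])
    obtain \<alpha> :: ereal where below: "\<And>x. 0 < x \<Longrightarrow> ereal x < \<alpha> \<Longrightarrow> 0 < right_deriv p x"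
      and above: "\<And>x. 0 < x \<Longrightarrow> \<alpha> \<le> ereal x \<Longrightarrow> right_deriv p x = 0"
      and super: "\<And>x y. 0 < x \<Longrightarrow> 0 < y \<Longrightarrow> ereal (x + y) < \<alpha> \<Longrightarrow>
        p x / right_deriv p x + p y / right_deriv p y \<le> p (x + y) / right_deriv p (x + y)"
      using ex by blast
    have nonneg: "0 \<le> right_deriv p x" if "0 < x" for x
      using below[OF that] above[OF that] by (cases "ereal x < \<alpha>") auto
    interpret semismooth_generator f
    proof
      show ?csd by (rule csd')
      fix x y A B :: real
      assume xy: "0 < x" "0 < y"
      then have pp: "0 < p x" "0 < p y" "0 < p (x + y)"
        by simp_all
      show "right_deriv p (x + y) / p (x + y) * (A + B)\<^sup>2
          \<le> right_deriv p x / p x * A\<^sup>2 + right_deriv p y / p y * B\<^sup>2"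
      proof (cases "ereal (x + y) < \<alpha>")
        case True
        have "ereal x < ereal (x + y)" "ereal y < ereal (x + y)"
          using xy by simp_all
        then have "ereal x < \<alpha>" "ereal y < \<alpha>"
          using True less_trans by blast+
        then show ?thesis
          using super[OF xy True] below True xy pp by (intro harmonic_quadratic) auto
      next
        \<comment> \<open>At or beyond \<alpha> the left side is 0, while the right side is
          nonnegative because f''_+ is nonnegative everywhere.\<close>
        case False
        then have "right_deriv p (x + y) = 0"
          using above[of "x + y"] xy by simp
        then show ?thesis
          using nonneg[OF xy(1)] nonneg[OF xy(2)] pp by (simp add: add_nonneg_nonneg)
      qed
    qed
    show ?thesis
      by (rule concave_Phi)
  qed
  ultimately show ?thesis
    by blast
qed

end
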